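(* For all integers $d\geq 1$ the following hold: (1) $R_{d,3}\leq 2.854\cdot 3^d$; (2) $R_{d,4}\leq 1.749\cdot 4^d$; (3) $R_{d,5}\leq 1.263\cdot 5^d$; (4) $R_{d,6}\leq 0.994\cdot 6^d$; (5) $R_{d,7}\leq 0.814\cdot 7^d$.
   Context: A function $f:\mathbb{Z}_q^n\to\{0,1\}$ ($n$ a positive integer) is called Boolean. Identify $\mathbb{Z}_q$ with $\{0,1,\ldots,q-1\}\subset\mathbb{R}$. Every function $f:\mathbb{Z}_q^n\to\mathbb{R}$ has a unique representation $f=\sum_{u\in\{0,\ldots,q-1\}^n}\alpha_u x^u$ with $\alpha_u\in\mathbb{R}$ and $x^u=x_1^{u_1}\cdots x_n^{u_n}$ (a real polynomial of degree at most $q-1$ in each variable, agreeing with $f$ on $\{0,\ldots,q-1\}^n$). For $u\in\mathbb{Z}_q^n$, the weight $|u|$ is the number of non-zero coordinates of $u$. The degree of $f$ is $\deg(f)=\max\{|u|:\alpha_u\neq 0\}$ (and $\deg(f)=0$ if $f\equiv 0$); equivalently, it is the smallest $t\ge 0$ such that $f$ is a sum of functions each depending on at most $t$ variables. A variable $x_i$ is relevant for $f$ if there are $x,y\in\mathbb{Z}_q^n$ differing only in position $i$ with $f(x)\neq f(y)$; $R(f)$ is the number of relevant variables of $f$. $R_{d,q}$ is the maximum of $R(f)$ over all $n$ and all Boolean functions $f$ on $\mathbb{Z}_q^n$ of degree at most $d$. *)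

theory Defs
  imports
    "HOL-Library.FuncSet"
    "HOL-Library.Extended_Nat"
    "HOL-Library.Extended_Real"
    "HOL-Computational_Algebra.Polynomial"
begin

text \<open>
  Points of \<open>\<int>\<^sub>q\<^sup>n\<close> (and likewise exponent vectors in \<open>{0,\<dots>,q-1}\<^sup>n\<close>) are extensional
  functions, with the coordinates indexed by \<open>0,\<dots>,n-1\<close>. A function on \<open>\<int>\<^sub>q\<^sup>n\<close> is a function on
  type \<^typ>\<open>nat \<Rightarrow> nat\<close>, of which only the values on the cube matter in the definitions below.
\<close>

definition cube :: "nat \<Rightarrow> nat \<Rightarrow> (nat \<Rightarrow> nat) set" where
  "cube n q = {..<n} \<rightarrow>\<^sub>E {..<q}"

definition monomial_at :: "nat \<Rightarrow> (nat \<Rightarrow> nat) \<Rightarrow> (nat \<Rightarrow> nat) \<Rightarrow> real" where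
  "monomial_at n u x = (\<Prod>i<n. real (x i) ^ u i)"

definition represents ::
  "nat \<Rightarrow> nat \<Rightarrow> ((nat \<Rightarrow> nat) \<Rightarrow> real) \<Rightarrow> ((nat \<Rightarrow> nat) \<Rightarrow> real) \<Rightarrow> bool" where
  "represents n q \<alpha> f \<longleftrightarrow>
     (\<forall>x\<in>cube n q. f x = (\<Sum>u\<in>cube n q. \<alpha> u * monomial_at n u x))"

definition poly_coeffs ::
  "nat \<Rightarrow> nat \<Rightarrow> ((nat \<Rightarrow> nat) \<Rightarrow> real) \<Rightarrow> (nat \<Rightarrow> nat) \<Rightarrow> real" where
  "poly_coeffs n q f = (THE \<alpha>. \<alpha> \<in> extensional (cube n q) \<and> represents n q \<alpha> f)"

definition weight :: "nat \<Rightarrow> (nat \<Rightarrow> nat) \<Rightarrow> nat" where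
  "weight n u = card {i\<in>{..<n}. u i \<noteq> 0}"

text \<open>Inserting \<open>0\<close> affects the maximum only for the zero function, whose degree is \<open>0\<close>.\<close>

definition fun_degree :: "nat \<Rightarrow> nat \<Rightarrow> ((nat \<Rightarrow> nat) \<Rightarrow> real) \<Rightarrow> nat" where
  "fun_degree n q f = Max (insert 0 {weight n u | u. u \<in> cube n q \<and> poly_coeffs n q f u \<noteq> 0})"

definition boolean_fun :: "nat \<Rightarrow> nat \<Rightarrow> ((nat \<Rightarrow> nat) \<Rightarrow> real) \<Rightarrow> bool" where
  "boolean_fun n q f \<longleftrightarrow> (\<forall>x\<in>cube n q. f x \<in> {0, 1})"

definition relevant_var :: "nat \<Rightarrow> nat \<Rightarrow> ((nat \<Rightarrow> nat) \<Rightarrow> real) \<Rightarrow> nat \<Rightarrow> bool" where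
  "relevant_var n q f i \<longleftrightarrow>
     i < n \<and> (\<exists>x\<in>cube n q. \<exists>y\<in>cube n q. (\<forall>j<n. j \<noteq> i \<longrightarrow> x j = y j) \<and> f x \<noteq> f y)"

definition num_relevant :: "nat \<Rightarrow> nat \<Rightarrow> ((nat \<Rightarrow> nat) \<Rightarrow> real) \<Rightarrow> nat" where
  "num_relevant n q f = card {i. relevant_var n q f i}"

text \<open>
  The supremum is taken in \<^typ>\<open>enat\<close>, so that it is \<open>\<infinity>\<close> if the set is unbounded; when it is finite
  it is a maximum (\<open>max_relevant_attained\<close>).
\<close>

definition max_relevant :: "nat \<Rightarrow> nat \<Rightarrow> enat" where
  "max_relevant d q =
     Sup {enat (num_relevant n q f) | n f. n \<ge> 1 \<and> boolean_fun n q f \<and> fun_degree n q f \<le> d}"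

lemma finite_cube [simp]: "finite (cube n q)"
  by (simp add: cube_def finite_PiE)

text \<open>Existence and uniqueness of the polynomial representation, by tensorised Lagrange interpolation.\<close>

definition lagrange_basis :: "nat \<Rightarrow> nat \<Rightarrow> real poly" where
  "lagrange_basis q a =
     (\<Prod>b\<in>{..<q} - {a}. smult (1 / (real a - real b)) [:- real b, 1:])"

lemma degree_lagrange_basis:
  assumes "a < q"
  shows "degree (lagrange_basis q a) < q"
proof -
  have "degree (lagrange_basis q a)
          \<le> (\<Sum>b\<in>{..<q} - {a}. degree (smult (1 / (real a - real b)) [:- real b, 1:]))"
    unfolding lagrange_basis_def by (rule order.trans[OF degree_prod_sum_le]) (simp_all add: o_def)
  also have "\<dots> \<le> (\<Sum>b\<in>{..<q} - {a}. 1)"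
    by (intro sum_mono order.trans[OF degree_smult_le]) simp
  also have "\<dots> < q"
    using assms by simp
  finally show ?thesis .
qed

lemma poly_lagrange_basis:
  assumes "a < q" "x < q"
  shows "poly (lagrange_basis q a) (real x) = (if x = a then 1 else 0)"
proof (cases "x = a")
  case True
  have "(1 / (real a - real b)) * (real a - real b) = 1" if "b \<noteq> a" for b
    using that by simp
  with True show ?thesis
    by (simp add: lagrange_basis_def poly_prod left_diff_distrib right_diff_distrib)
next
  case False
  with assms show ?thesis
    by (auto simp: lagrange_basis_def poly_prod intro!: prod_zero)
qed

lemma lagrange_basis_right:
  assumes "a < q" "x < q"
  shows "(\<Sum>k<q. coeff (lagrange_basis q a) k * real x ^ k) = (if x = a then 1 else 0)"
proof -
  have "(\<Sum>k<q. coeff (lagrange_basis q a) k * real x ^ k) = poly (lagrange_basis q a) (real x)"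
    unfolding poly_altdef using degree_lagrange_basis[OF assms(1)]
    by (intro sum.mono_neutral_right) (auto simp: coeff_eq_0)
  then show ?thesis
    by (simp add: poly_lagrange_basis assms)
qed

lemma lagrange_basis_left:
  assumes "k < q" "l < q"
  shows "(\<Sum>a<q. coeff (lagrange_basis q a) l * real a ^ k) = (if k = l then 1 else 0)"
proof -
  have "(\<Sum>a<q. smult (real a ^ k) (lagrange_basis q a)) = monom 1 k"
  proof (rule poly_eqI_degree[where A = "real ` {..<q}"])
    fix x :: real assume "x \<in> real ` {..<q}"
    then obtain m where m: "m < q" "x = real m"
      by auto
    have "poly (\<Sum>a<q. smult (real a ^ k) (lagrange_basis q a)) x
            = (\<Sum>a<q. if a = m then real m ^ k else 0)"
      unfolding poly_sum using m by (intro sum.cong) (auto simp: poly_lagrange_basis)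
    also have "\<dots> = poly (monom 1 k) x"
      using m by (simp add: poly_monom)
    finally show "poly (\<Sum>a<q. smult (real a ^ k) (lagrange_basis q a)) x = poly (monom 1 k) x" .
  next
    have "degree (\<Sum>a<q. smult (real a ^ k) (lagrange_basis q a)) < q"
      using assms by (intro degree_sum_less le_less_trans[OF degree_smult_le]) (auto simp: degree_lagrange_basis)
    then show "degree (\<Sum>a<q. smult (real a ^ k) (lagrange_basis q a)) < card (real ` {..<q})"
      by (simp add: card_image)
    show "degree (monom 1 k :: real poly) < card (real ` {..<q})"
      using assms by (simp add: card_image degree_monom_eq)
  qed
  then have "coeff (\<Sum>a<q. smult (real a ^ k) (lagrange_basis q a)) l = coeff (monom 1 k) l"
    by simp
  then show ?thesis
    by (simp add: coeff_sum mult.commute)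
qed

lemma prod_indicator_cube:
  assumes "x \<in> cube n q" "y \<in> cube n q"
  shows "(\<Prod>i<n. if x i = y i then 1 else 0 :: real) = (if x = y then 1 else 0)"
proof (cases "x = y")
  case False
  then obtain i where "i < n" "x i \<noteq> y i"
    using assms unfolding cube_def by (metis PiE_ext lessThan_iff)
  with False show ?thesis
    by (auto intro!: prod_zero)
qed simp

lemma ex1_represents: "\<exists>!\<alpha>. \<alpha> \<in> extensional (cube n q) \<and> represents n q \<alpha> f"
proof -
  define C where "C x u = (\<Prod>i<n. coeff (lagrange_basis q (x i)) (u i))" for x u
  define \<beta> where "\<beta> = restrict (\<lambda>u. \<Sum>a\<in>cube n q. f a * C a u) (cube n q)"
  have right: "(\<Sum>u\<in>cube n q. C a u * monomial_at n u x) = (if x = a then 1 else 0)"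
    if "a \<in> cube n q" "x \<in> cube n q" for a x
  proof -
    have "(\<Sum>u\<in>cube n q. C a u * monomial_at n u x)
            = (\<Prod>i<n. \<Sum>k<q. coeff (lagrange_basis q (a i)) k * real (x i) ^ k)"
      by (subst prod_sum_PiE) (auto simp: cube_def C_def monomial_at_def prod.distrib)
    also have "\<dots> = (\<Prod>i<n. if x i = a i then 1 else 0)"
      using that by (intro prod.cong lagrange_basis_right) (auto simp: cube_def)
    finally show ?thesis
      using that by (simp add: prod_indicator_cube)
  qed
  have left: "(\<Sum>x\<in>cube n q. C x v * monomial_at n u x) = (if u = v then 1 else 0)"
    if "u \<in> cube n q" "v \<in> cube n q" for u v
  proof -
    have "(\<Sum>x\<in>cube n q. C x v * monomial_at n u x)
            = (\<Prod>i<n. \<Sum>a<q. coeff (lagrange_basis q a) (v i) * real a ^ u i)"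
      by (subst prod_sum_PiE) (auto simp: cube_def C_def monomial_at_def prod.distrib)
    also have "\<dots> = (\<Prod>i<n. if u i = v i then 1 else 0)"
      using that by (intro prod.cong lagrange_basis_left) (auto simp: cube_def)
    finally show ?thesis
      using that by (simp add: prod_indicator_cube)
  qed
  have "represents n q \<beta> f"
    unfolding represents_def
  proof
    fix x assume x: "x \<in> cube n q"
    have "(\<Sum>u\<in>cube n q. \<beta> u * monomial_at n u x)
            = (\<Sum>u\<in>cube n q. \<Sum>a\<in>cube n q. f a * (C a u * monomial_at n u x))"
      by (simp add: \<beta>_def sum_distrib_right mult.assoc)
    also have "\<dots> = (\<Sum>a\<in>cube n q. f a * (\<Sum>u\<in>cube n q. C a u * monomial_at n u x))"
      by (subst sum.swap) (simp add: sum_distrib_left)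
    also have "\<dots> = (\<Sum>a\<in>cube n q. if x = a then f a else 0)"
      by (intro sum.cong) (auto simp: right x)
    finally show "f x = (\<Sum>u\<in>cube n q. \<beta> u * monomial_at n u x)"
      using x by simp
  qed
  moreover have "\<alpha> = \<beta>" if \<alpha>: "\<alpha> \<in> extensional (cube n q)" "represents n q \<alpha> f" for \<alpha>
  proof (rule extensionalityI[OF \<alpha>(1)])
    show "\<beta> \<in> extensional (cube n q)"
      by (simp add: \<beta>_def)
    fix v assume v: "v \<in> cube n q"
    have "\<beta> v = (\<Sum>x\<in>cube n q. \<Sum>u\<in>cube n q. \<alpha> u * (C x v * monomial_at n u x))"
      using \<alpha>(2) v by (simp add: \<beta>_def represents_def sum_distrib_left sum_distrib_right mult_ac)
    also have "\<dots> = (\<Sum>u\<in>cube n q. \<alpha> u * (\<Sum>x\<in>cube n q. C x v * monomial_at n u x))"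
      by (subst sum.swap) (simp add: sum_distrib_left)
    also have "\<dots> = (\<Sum>u\<in>cube n q. if u = v then \<alpha> u else 0)"
      by (intro sum.cong) (auto simp: left v)
    finally show "\<alpha> v = \<beta> v"
      using v by simp
  qed
  moreover have "\<beta> \<in> extensional (cube n q)"
    by (simp add: \<beta>_def)
  ultimately show ?thesis
    by blast
qed

lemma represents_poly_coeffs: "represents n q (poly_coeffs n q f) f"
  using theI'[OF ex1_represents] unfolding poly_coeffs_def by blast

lemma max_relevant_attained:
  assumes "max_relevant d q = enat m"
  shows "\<exists>n f. n \<ge> 1 \<and> boolean_fun n q f \<and> fun_degree n q f \<le> d \<and> num_relevant n q f = m"
proof -
  let ?S = "{enat (num_relevant n q f) | n f. n \<ge> 1 \<and> boolean_fun n q f \<and> fun_degree n q f \<le> d}"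
  have "represents 1 q (restrict (\<lambda>_. 0) (cube 1 q)) (\<lambda>_. 0)"
    by (simp add: represents_def)
  then have "poly_coeffs 1 q (\<lambda>_. 0) = restrict (\<lambda>_. 0) (cube 1 q)"
    unfolding poly_coeffs_def by (intro the1_equality[OF ex1_represents]) auto
  then have "fun_degree 1 q (\<lambda>_. 0) = Max (insert 0 {})"
    unfolding fun_degree_def by (intro arg_cong[where f = Max] arg_cong[where f = "insert 0"]) auto
  then have "enat (num_relevant 1 q (\<lambda>_. 0)) \<in> ?S"
    by (auto simp: boolean_fun_def intro!: exI[of _ "1 :: nat"] exI[of _ "\<lambda>_. 0 :: real"])
  then have ne: "?S \<noteq> {}"
    by blast
  have Sup: "Sup ?S = enat m"
    using assms unfolding max_relevant_def .
  then have fin: "finite ?S"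
    using ne unfolding Sup_enat_def by (metis enat.distinct(2))
  have "Sup ?S = Max ?S"
    unfolding Sup_enat_def if_not_P[OF ne] if_P[OF fin] ..
  then have "enat m \<in> ?S"
    using Max_in[OF fin ne] unfolding Sup by metis
  then show ?thesis
    by auto
qed

end

theory Submission
  imports Defs "HOL-Library.Numeral_Type" "HOL-Library.Disjoint_Sets"
begin

text \<open>
  Give a relevant variable \<open>i\<close> the weight \<open>q\<close> to the power \<open>-k\<close>, where \<open>k\<close> bounds the degree of all
  differences of \<open>f\<close> in direction \<open>i\<close>; for degree at most \<open>d\<close> we have \<open>k \<le> d - 1\<close>, so a bound \<open>q C\<close>
  on the total weight gives \<open>R(f) \<le> C q\<^sup>d\<close>. Two estimates of the total weight are combined.
  (a) The total influence is at most \<open>d Var f \<le> d / 4\<close>, and a nonzero function of degree \<open>k\<close> is nonzero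
  on a fraction of at least \<open>1 / q\<^sup>k\<close> of the points; hence \<open>C \<le> d q / (4 (q - 1))\<close>.
  (b) Fixing a variable does not decrease the weight of the others on average. Represent \<open>f\<close> as a sum of juntas
  with as few \<open>d\<close>-element sets as possible. By minimality \<open>f\<close> is sensitive to each of these sets at
  every point, so by the argument of Nisan and Szegedy fewer than \<open>2 d\<^sup>2\<close> of them are pairwise disjoint, and
  the union \<open>H\<close> of a maximal disjoint subfamily has at most \<open>2 d\<^sup>3\<close> elements. Fixing the variables in \<open>H\<close>
  lowers the degree, while each variable in \<open>H\<close> has weight at most \<open>q\<close> to the power \<open>-(d - 1)\<close>.
  Using (a) up to a suitable degree \<open>m\<close> and (b) above it gives
  \<open>C \<le> m q / (4 (q - 1)) + (\<Sum>e > m. 2 e\<^sup>3 / q\<^sup>e)\<close>.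
\<close>

section \<open>Functions of bounded degree\<close>

text \<open>Points are functions on all of \<open>nat\<close> with values in a type
  \<open>'a\<close>, so no membership in a cube has to be carried along; in the end
  \<open>'a\<close> has exactly \<open>q\<close> elements.\<close>

definition depends_on :: "nat set \<Rightarrow> ((nat \<Rightarrow> 'a) \<Rightarrow> real) \<Rightarrow> bool" where
  "depends_on A f \<longleftrightarrow> (\<forall>x y. (\<forall>i\<in>A. x i = y i) \<longrightarrow> f x = f y)"

definition spanned :: "nat set set \<Rightarrow> ((nat \<Rightarrow> 'a) \<Rightarrow> real) set" where
  "spanned \<F> = {f. \<exists>c. (\<forall>S\<in>\<F>. depends_on S (c S)) \<and> f = (\<lambda>x. \<Sum>S\<in>\<F>. c S x)}"

lemma depends_onD: "depends_on A f \<Longrightarrow> (\<And>i. i \<in> A \<Longrightarrow> x i = y i) \<Longrightarrow> f x = f y"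
  unfolding depends_on_def by blast

lemma spanned_junta:
  assumes "finite \<F>" "S \<in> \<F>" "depends_on A h" "A \<subseteq> S"
  shows "h \<in> spanned \<F>"
proof -
  have "h = (\<lambda>x. \<Sum>T\<in>\<F>. (if T = S then h else (\<lambda>_. 0)) x)"
    using assms by (simp add: if_distribR)
  moreover have "\<forall>T\<in>\<F>. depends_on T (if T = S then h else (\<lambda>_. 0))"
    using assms(3,4) by (auto simp: depends_on_def)
  ultimately show ?thesis
    unfolding spanned_def by (intro CollectI exI[of _ "\<lambda>T. if T = S then h else (\<lambda>_. 0)"] conjI)
qed

lemma spanned_zero [simp]: "(\<lambda>_. 0) \<in> spanned \<F>"
  unfolding spanned_def by (auto simp: depends_on_def intro!: exI[of _ "\<lambda>_ _. 0"])

lemma spanned_add: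
  assumes "f \<in> spanned \<F>" "g \<in> spanned \<F>"
  shows "(\<lambda>x. f x + g x) \<in> spanned \<F>"
proof -
  from assms obtain c c' where c: "\<forall>S\<in>\<F>. depends_on S (c S)" "f = (\<lambda>x. \<Sum>S\<in>\<F>. c S x)"
    "\<forall>S\<in>\<F>. depends_on S (c' S)" "g = (\<lambda>x. \<Sum>S\<in>\<F>. c' S x)"
    unfolding spanned_def by auto
  have "depends_on S (\<lambda>x. c S x + c' S x)" if "S \<in> \<F>" for S
    using c(1,3) that unfolding depends_on_def by metis
  moreover have "(\<lambda>x. f x + g x) = (\<lambda>x. \<Sum>S\<in>\<F>. c S x + c' S x)"
    by (simp add: c(2,4) sum.distrib)
  ultimately show ?thesis
    unfolding spanned_def by (intro CollectI exI[of _ "\<lambda>S x. c S x + c' S x"]) simp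
qed

lemma spanned_cmult:
  assumes "f \<in> spanned \<F>"
  shows "(\<lambda>x. r * f x) \<in> spanned \<F>"
proof -
  from assms obtain c where c: "\<forall>S\<in>\<F>. depends_on S (c S)" "f = (\<lambda>x. \<Sum>S\<in>\<F>. c S x)"
    unfolding spanned_def by auto
  have "depends_on S (\<lambda>x. r * c S x)" if "S \<in> \<F>" for S
    using c(1) that unfolding depends_on_def by metis
  moreover have "(\<lambda>x. r * f x) = (\<lambda>x. \<Sum>S\<in>\<F>. r * c S x)"
    by (simp add: c(2) sum_distrib_left)
  ultimately show ?thesis
    unfolding spanned_def by (intro CollectI exI[of _ "\<lambda>S x. r * c S x"]) simp
qed

lemma spanned_diff:
  assumes "f \<in> spanned \<F>" "g \<in> spanned \<F>"
  shows "(\<lambda>x. f x - g x) \<in> spanned \<F>"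
  using spanned_add[OF assms(1) spanned_cmult[OF assms(2), of "-1"]] by simp

lemma spanned_sum:
  assumes "\<And>i. i \<in> I \<Longrightarrow> f i \<in> spanned \<F>"
  shows "(\<lambda>x. \<Sum>i\<in>I. f i x) \<in> spanned \<F>"
  using assms
proof (induction I rule: infinite_finite_induct)
  case (insert i I)
  then show ?case
    using spanned_add[of "f i" \<F> "\<lambda>x. \<Sum>i\<in>I. f i x"] by simp
qed simp_all

text \<open>An operator that commutes with the sum over \<open>\<F>\<close> only has to be checked
  on single juntas. Most closure properties below go through this.\<close>

lemma spanned_linear:
  assumes "f \<in> spanned \<F>"
    and "\<And>c. L (\<lambda>x. \<Sum>S\<in>\<F>. c S x) = (\<lambda>x. \<Sum>S\<in>\<F>. L (c S) x)"
    and "\<And>S c. S \<in> \<F> \<Longrightarrow> depends_on S c \<Longrightarrow> L c \<in> spanned \<G>"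
  shows "L f \<in> spanned \<G>"
proof -
  from assms(1) obtain c where c: "\<forall>S\<in>\<F>. depends_on S (c S)" "f = (\<lambda>x. \<Sum>S\<in>\<F>. c S x)"
    unfolding spanned_def by auto
  show ?thesis
    unfolding c(2) assms(2) using c(1) assms(3) by (intro spanned_sum) auto
qed

lemma spanned_mono:
  assumes "f \<in> spanned \<F>" "finite \<G>" "\<And>S. S \<in> \<F> \<Longrightarrow> \<exists>T\<in>\<G>. S \<subseteq> T"
  shows "f \<in> spanned \<G>"
  using spanned_linear[where L = "\<lambda>f. f", OF assms(1)] spanned_junta[OF assms(2)] assms(3)
  by blast

section \<open>Restrictions, differences and the degree filtration\<close>

definition restr :: "nat \<Rightarrow> 'a \<Rightarrow> ((nat \<Rightarrow> 'a) \<Rightarrow> real) \<Rightarrow> (nat \<Rightarrow> 'a) \<Rightarrow> real" where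
  "restr j a f = (\<lambda>x. f (x(j := a)))"

definition diff :: "nat \<Rightarrow> 'a \<Rightarrow> 'a \<Rightarrow> ((nat \<Rightarrow> 'a) \<Rightarrow> real) \<Rightarrow> (nat \<Rightarrow> 'a) \<Rightarrow> real" where
  "diff i a b f = (\<lambda>x. f (x(i := a)) - f (x(i := b)))"

text \<open>Degree at most \<open>k\<close> in its junta form, on the first \<open>n\<close>
  coordinates; in this form stability under fixing coordinates is immediate.\<close>

definition low :: "nat \<Rightarrow> nat \<Rightarrow> ((nat \<Rightarrow> 'a) \<Rightarrow> real) set" where
  "low n k = spanned {S. S \<subseteq> {..<n} \<and> card S \<le> k}"

lemma finite_low_family [simp]: "finite {S. S \<subseteq> {..<n::nat} \<and> P S}"
  by (rule finite_subset[of _ "Pow {..<n}"]) auto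

lemma low_linear:
  assumes "f \<in> low n k"
    and "\<And>c. L (\<lambda>x. \<Sum>S\<in>{S. S \<subseteq> {..<n} \<and> card S \<le> k}. c S x) =
              (\<lambda>x. \<Sum>S\<in>{S. S \<subseteq> {..<n} \<and> card S \<le> k}. L (c S) x)"
    and "\<And>S c. finite S \<Longrightarrow> S \<subseteq> {..<n} \<Longrightarrow> card S \<le> k \<Longrightarrow> depends_on S c \<Longrightarrow> L c \<in> low m l"
  shows "L f \<in> low m l"
  using assms(1) unfolding low_def
proof (rule spanned_linear[where L = L])
  fix S :: "nat set" and c :: "(nat \<Rightarrow> 'a) \<Rightarrow> real"
  assume S: "S \<in> {S. S \<subseteq> {..<n} \<and> card S \<le> k}" "depends_on S c"
  then have "L c \<in> low m l"
    by (intro assms(3)[of S]) (auto intro: finite_subset)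
  then show "L c \<in> spanned {S. S \<subseteq> {..<m} \<and> card S \<le> l}"
    unfolding low_def .
qed (rule assms(2))

lemma low_junta:
  assumes "depends_on A h" "A \<subseteq> {..<n}" "card A \<le> k"
  shows "h \<in> low n k"
  unfolding low_def using assms by (intro spanned_junta[where A = A and S = A]) auto

lemma depends_on_restr: "depends_on A f \<Longrightarrow> depends_on (A - {j}) (restr j a f)"
  unfolding depends_on_def restr_def by (metis Diff_iff fun_upd_apply singletonD)

lemma depends_on_diff: "depends_on A f \<Longrightarrow> depends_on (A - {j}) (diff j a b f)"
  using depends_on_restr[of A f j a] depends_on_restr[of A f j b]
  unfolding depends_on_def restr_def diff_def by presburger

lemma diff_irrelevant: "depends_on A f \<Longrightarrow> j \<notin> A \<Longrightarrow> diff j a b f = (\<lambda>_. 0)"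
  by (auto simp: diff_def depends_on_def fun_eq_iff)

lemma low_depends_on:
  assumes "f \<in> low n k"
  shows "depends_on {..<n} f"
proof -
  from assms obtain c where c: "\<forall>S\<in>{S. S \<subseteq> {..<n} \<and> card S \<le> k}. depends_on S (c S)"
    "f = (\<lambda>x. \<Sum>S\<in>{S. S \<subseteq> {..<n} \<and> card S \<le> k}. c S x)"
    unfolding low_def spanned_def by auto
  have "c S x = c S y" if "S \<subseteq> {..<n}" "card S \<le> k" "\<forall>i\<in>{..<n}. x i = y i" for S x y
    using c(1) that by (intro depends_onD[of S "c S"]) auto
  then show ?thesis
    unfolding depends_on_def c(2) by (auto intro!: sum.cong)
qed

lemma low_restr:
  assumes "f \<in> low n k"
  shows "restr j a f \<in> low n k"
proof (rule low_linear[where L = "restr j a", OF assms])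
  fix S :: "nat set" and c :: "(nat \<Rightarrow> 'a) \<Rightarrow> real"
  assume "finite S" "S \<subseteq> {..<n}" "card S \<le> k" "depends_on S c"
  then show "restr j a c \<in> low n k"
    by (intro low_junta[OF depends_on_restr]) (auto intro: order.trans[OF card_mono])
qed (simp add: restr_def)

lemma low_restr_last:
  assumes "f \<in> low (Suc n) k"
  shows "restr n a f \<in> low n k"
proof (rule low_linear[where L = "restr n a", OF assms])
  fix S :: "nat set" and c :: "(nat \<Rightarrow> 'a) \<Rightarrow> real"
  assume "finite S" "S \<subseteq> {..<Suc n}" "card S \<le> k" "depends_on S c"
  then show "restr n a c \<in> low n k"
    by (intro low_junta[OF depends_on_restr]) (auto simp: less_Suc_eq intro: order.trans[OF card_mono])
qed (simp add: restr_def)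

text \<open>A junta on \<open>S\<close> loses the coordinate \<open>j\<close> if \<open>j\<close>
  lies in \<open>S\<close> and is annihilated otherwise.\<close>

lemma diff_in_low:
  assumes "f \<in> low n (Suc k)"
  shows "diff j a b f \<in> low n k"
proof (rule low_linear[where L = "diff j a b", OF assms])
  fix S :: "nat set" and c :: "(nat \<Rightarrow> 'a) \<Rightarrow> real"
  assume S: "finite S" "S \<subseteq> {..<n}" "card S \<le> Suc k" "depends_on S c"
  show "diff j a b c \<in> low n k"
  proof (cases "j \<in> S")
    case True
    with S show ?thesis
      by (intro low_junta[OF depends_on_diff]) auto
  next
    case False
    then show ?thesis
      using diff_irrelevant[OF S(4) False] by (simp add: low_def)
  qed
qed (simp add: diff_def sum_subtractf)

lemma low_0_const:
  assumes "f \<in> low n 0"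
  shows "f x = f y"
proof -
  have "{S. S \<subseteq> {..<n} \<and> card S \<le> 0} = {{}}"
    using finite_subset by fastforce
  with assms show ?thesis
    by (auto simp: low_def spanned_def depends_on_def)
qed

lemma diff_low_0: "f \<in> low n 0 \<Longrightarrow> diff j a b f = (\<lambda>_. 0)"
  using low_0_const[of f n] by (auto simp: diff_def)

lemma low_diff:
  assumes "f \<in> low n k"
  shows "diff j a b f \<in> low n (k - 1)"
proof (cases k)
  case 0
  then show ?thesis
    using assms diff_low_0[of f n] by (simp add: low_def)
next
  case (Suc k')
  then show ?thesis
    using assms diff_in_low[of f n k'] by simp
qed

lemma diff_eq_restr: "diff j a b f = (\<lambda>x. restr j a f x - restr j b f x)"
  by (simp add: diff_def restr_def)

text \<open>The difference no longer depends on coordinate \<open>n\<close>, so fixing that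
  coordinate leaves it unchanged while removing \<open>n\<close> from all index sets.\<close>

lemma diff_diff_last:
  assumes "f \<in> low (Suc n) k"
  shows "diff n a b f \<in> low n (k - 1)"
proof -
  have "restr n a (diff n a b f) = diff n a b f"
    by (simp add: restr_def diff_def)
  then show ?thesis
    using low_restr_last[OF low_diff[OF assms]] by metis
qed

text \<open>The mean over the first \<open>n\<close> coordinates; the others are set to a junk value, so the functions of interest depend on the coordinates below \<open>n\<close> only.\<close>

primrec mean :: "nat \<Rightarrow> ((nat \<Rightarrow> 'a::finite) \<Rightarrow> real) \<Rightarrow> real" where
  "mean 0 f = f (\<lambda>_. undefined)"
| "mean (Suc n) f = (\<Sum>a\<in>UNIV. mean n (restr n a f)) / CARD('a)"

lemma mean_add: "mean n (\<lambda>x. f x + g x) = mean n f + mean n g"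
  by (induction n arbitrary: f g) (simp_all add: restr_def sum.distrib add_divide_distrib)

lemma mean_cmult: "mean n (\<lambda>x. r * f x) = r * mean n f"
  by (induction n arbitrary: f) (simp_all add: restr_def flip: sum_distrib_left)

lemma mean_zero [simp]: "mean n (\<lambda>_. 0) = 0"
  using mean_cmult[of n 0 "\<lambda>_. 0"] by simp

lemma mean_sum: "mean n (\<lambda>x. \<Sum>i\<in>I. f i x) = (\<Sum>i\<in>I. mean n (f i))"
  by (induction I rule: infinite_finite_induct) (simp_all add: mean_add)

lemma mean_mono: "(\<And>x. f x \<le> g x) \<Longrightarrow> mean n f \<le> mean n g"
proof (induction n arbitrary: f g)
  case (Suc n)
  then show ?case
    by (auto intro!: divide_right_mono sum_mono Suc.IH simp: restr_def)
qed simp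

lemma mean_nonneg: "(\<And>x. 0 \<le> f x) \<Longrightarrow> 0 \<le> mean n f"
  using mean_mono[of "\<lambda>_. 0" f n] by simp

section \<open>Averages along lines and the density of nonzero points\<close>

definition line_avg :: "nat \<Rightarrow> ((nat \<Rightarrow> 'a::finite) \<Rightarrow> real) \<Rightarrow> (nat \<Rightarrow> 'a) \<Rightarrow> real" where
  "line_avg i f = (\<lambda>x. (\<Sum>a\<in>UNIV. f (x(i := a))) / CARD('a))"

lemma restr_line_avg: "i \<noteq> j \<Longrightarrow> restr j a (line_avg i f) = line_avg i (restr j a f)"
  by (auto simp: restr_def line_avg_def fun_upd_twist)

lemma mean_line_avg: "i < n \<Longrightarrow> mean n (line_avg i f) = mean n f"
proof (induction n arbitrary: f)
  case (Suc n)
  show ?case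
  proof (cases "i = n")
    case True
    have "restr n a (line_avg n f) = (\<lambda>x. 1 / CARD('a) * (\<Sum>b\<in>UNIV. restr n b f x))" for a
      by (simp add: restr_def line_avg_def)
    then show ?thesis
      unfolding True mean.simps by (simp only: mean_cmult mean_sum) simp
  next
    case False
    with Suc show ?thesis
      by (simp add: restr_line_avg)
  qed
qed simp

text \<open>A bound of Schwartz-Zippel type, by induction on \<open>n\<close>: either every slice in
  the last coordinate is nonzero and the bound averages, or some slice vanishes and a nonzero slice
  has smaller degree.\<close>

lemma nonzero_density:
  fixes f :: "(nat \<Rightarrow> 'a::finite) \<Rightarrow> real"
  assumes "f \<in> low n k" "f x \<noteq> 0"
  shows "1 / real CARD('a) ^ k \<le> mean n (\<lambda>x. if f x \<noteq> 0 then 1 else 0)"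
  using assms
proof (induction n arbitrary: f k x)
  case 0
  have "f (\<lambda>_. undefined) = f x"
    using depends_onD[OF low_depends_on[OF 0(1)]] by simp
  then show ?case
    using 0(2) by (simp add: Suc_le_eq)
next
  case (Suc n)
  let ?q = "real CARD('a)"
  let ?M = "\<lambda>a. mean n (\<lambda>x. if restr n a f x \<noteq> 0 then 1 else 0 :: real)"
  have M0: "?M a \<ge> 0" for a
    by (intro mean_nonneg) auto
  have eq: "mean (Suc n) (\<lambda>x. if f x \<noteq> 0 then 1 else 0) = (\<Sum>a\<in>UNIV. ?M a) / ?q"
    by (simp add: restr_def)
  show ?case
  proof (cases "\<forall>a. \<exists>y. restr n a f y \<noteq> 0")
    case True
    have "1 / ?q ^ k \<le> ?M a" for a
    proof -
      obtain y where "restr n a f y \<noteq> 0"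
        using True by blast
      then show ?thesis
        by (rule Suc.IH[OF low_restr_last[OF Suc.prems(1)]])
    qed
    then have "(\<Sum>a::'a\<in>UNIV. 1 / ?q ^ k) / ?q \<le> (\<Sum>a\<in>UNIV. ?M a) / ?q"
      by (intro divide_right_mono sum_mono) auto
    then show ?thesis
      unfolding eq by simp
  next
    case False
    then obtain b where b: "\<And>y. restr n b f y = 0"
      by blast
    \<comment> \<open>As the slice at \<open>b\<close> vanishes, the slice at the value taken from
      \<open>x\<close> equals a difference. Its degree drops by one, which pays for using one slice
      out of \<open>q\<close>.\<close>
    let ?a = "x n"
    have d: "diff n ?a b f = restr n ?a f"
      using b by (simp add: diff_eq_restr)
    have x: "restr n ?a f x \<noteq> 0"
      using Suc.prems(2) by (simp add: restr_def)
    have "k \<noteq> 0"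
    proof
      assume "k = 0"
      then have "restr n ?a f = (\<lambda>_. 0)"
        using diff_low_0[of f "Suc n" n ?a b] Suc.prems(1) d by simp
      with x show False
        by simp
    qed
    then obtain k' where k': "k = Suc k'"
      using not0_implies_Suc by blast
    have "restr n ?a f \<in> low n k'"
      using diff_diff_last[OF Suc.prems(1), of ?a b] d k' by simp
    then have "1 / ?q ^ k' \<le> ?M ?a"
      using x by (rule Suc.IH)
    also have "\<dots> \<le> (\<Sum>a\<in>UNIV. ?M a)"
      using M0 by (intro member_le_sum) auto
    finally have "1 / ?q ^ k' / ?q \<le> (\<Sum>a\<in>UNIV. ?M a) / ?q"
      by (intro divide_right_mono) auto
    then show ?thesis
      unfolding eq k' by (simp add: mult.commute)
  qed
qed

section \<open>Influences and weights\<close>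

text \<open>The expected variance along a line in direction \<open>i\<close>. This form makes sense
  for real values, which the induction below needs since averages and deviations are not
  Boolean.\<close>

definition influence :: "nat \<Rightarrow> nat \<Rightarrow> ((nat \<Rightarrow> 'a::finite) \<Rightarrow> real) \<Rightarrow> real" where
  "influence n i f = mean n (\<lambda>x. (f x - line_avg i f x)\<^sup>2)"

lemma line_avg_diff: "line_avg i (\<lambda>x. f x - g x) = (\<lambda>x. line_avg i f x - line_avg i g x)"
  by (simp add: line_avg_def sum_subtractf diff_divide_distrib)

lemma line_avg_sum: "line_avg i (\<lambda>x. \<Sum>a\<in>A. f a x) = (\<lambda>x. \<Sum>a\<in>A. line_avg i (f a) x)"
proof
  fix x
  show "line_avg i (\<lambda>x. \<Sum>a\<in>A. f a x) x = (\<Sum>a\<in>A. line_avg i (f a) x)"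
    unfolding line_avg_def by (subst sum.swap) (simp add: sum_divide_distrib)
qed

lemma line_avg_eq_restr: "line_avg i f = (\<lambda>x. (1 / CARD('a)) * (\<Sum>a\<in>UNIV. restr i a f x))"
  for f :: "(nat \<Rightarrow> 'a::finite) \<Rightarrow> real"
  by (simp add: line_avg_def restr_def)

lemma low_cmult: "f \<in> low n k \<Longrightarrow> (\<lambda>x. r * f x) \<in> low n k"
  unfolding low_def by (rule spanned_cmult)

lemma low_sum: "(\<And>i. i \<in> I \<Longrightarrow> f i \<in> low n k) \<Longrightarrow> (\<lambda>x. \<Sum>i\<in>I. f i x) \<in> low n k"
  unfolding low_def by (rule spanned_sum)

text \<open>Induction on \<open>n\<close>: split the restrictions of \<open>f\<close> to the values of the last coordinate into their average \<open>u\<close>, of degree \<open>d\<close>, and the deviations \<open>v a\<close>, of degree \<open>d - 1\<close>; the cross terms cancel because the deviations sum to zero.\<close>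

lemma sum_influence_le:
  fixes f :: "(nat \<Rightarrow> 'a::finite) \<Rightarrow> real"
  assumes "f \<in> low n d"
  shows "(\<Sum>i<n. influence n i f) \<le> real d * (mean n (\<lambda>x. (f x)\<^sup>2) - (mean n f)\<^sup>2)"
  using assms
proof (induction n arbitrary: d f)
  case 0
  then show ?case
    by simp
next
  case (Suc n)
  let ?q = "real CARD('a)"
  show ?case
  proof (cases d)
    case 0
    have "line_avg i f x = (\<Sum>a::'a\<in>UNIV. f x) / ?q" for i x
      unfolding line_avg_def using low_0_const[of f "Suc n"] Suc.prems 0
      by (intro arg_cong2[where f = "(/)"] sum.cong) auto
    then have "influence (Suc n) i f = 0" for i
      unfolding influence_def by simp
    then show ?thesis
      using 0 by (simp del: mean.simps)
  next
    case (Suc d')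
    define u where "u = line_avg n f"
    define F where "F a = restr n a f" for a
    define v where "v a = (\<lambda>x. F a x - u x)" for a
    have u_eq: "u = (\<lambda>x. (1 / ?q) * (\<Sum>a\<in>UNIV. F a x))"
      unfolding u_def F_def by (rule line_avg_eq_restr)
    have sum_v: "(\<Sum>a\<in>UNIV. v a x) = 0" for x
      unfolding v_def u_eq by (simp add: sum_subtractf)
    have F_low: "F a \<in> low n d" for a
      unfolding F_def by (rule low_restr_last[OF Suc.prems])
    then have u_low: "u \<in> low n d"
      unfolding u_eq by (intro low_cmult low_sum) auto
    \<comment> \<open>The deviation of a slice is the average of its differences to all
      slices.\<close>
    have v_low: "v a \<in> low n d'" for a
    proof -
      have "v a = (\<lambda>x. (1 / ?q) * (\<Sum>b\<in>UNIV. diff n a b f x))"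
        unfolding v_def u_eq F_def by (simp add: diff_eq_restr sum_subtractf algebra_simps)
      moreover have "diff n a b f \<in> low n d'" for b
        using diff_diff_last[OF Suc.prems] Suc by simp
      ultimately show ?thesis
        by (metis low_cmult low_sum)
    qed
    define U where "U i = (\<lambda>x. u x - line_avg i u x)" for i
    define V where "V i a = (\<lambda>x. v a x - line_avg i (v a) x)" for i a
    have sum_V: "(\<Sum>a\<in>UNIV. V i a x) = 0" for i x
    proof -
      have "(\<Sum>a\<in>UNIV. line_avg i (v a) x) = line_avg i (\<lambda>x. \<Sum>a\<in>UNIV. v a x) x"
        by (simp only: line_avg_sum)
      also have "\<dots> = 0"
        by (simp add: line_avg_def sum_v)
      finally show ?thesis
        unfolding V_def by (simp add: sum_subtractf sum_v)
    qed
    \<comment> \<open>Pythagoras on average over \<open>a\<close>; used for \<open>u\<close> and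
      \<open>v\<close> and again for their deviations \<open>U i\<close> and \<open>V i\<close> from
      line averages.\<close>
    have average_sq: "(\<Sum>a\<in>UNIV. mean n (\<lambda>x. (g x + h a x)\<^sup>2)) / ?q =
        mean n (\<lambda>x. (g x)\<^sup>2) + (\<Sum>a\<in>UNIV. mean n (\<lambda>x. (h a x)\<^sup>2)) / ?q"
      if "\<And>x. (\<Sum>a\<in>UNIV. h a x) = 0" for g and h :: "'a \<Rightarrow> (nat \<Rightarrow> 'a) \<Rightarrow> real"
    proof -
      have "(\<Sum>a\<in>UNIV. mean n (\<lambda>x. (g x + h a x)\<^sup>2)) =
          (\<Sum>a\<in>UNIV. mean n (\<lambda>x. (g x)\<^sup>2) + mean n (\<lambda>x. (h a x)\<^sup>2) + 2 * mean n (\<lambda>x. g x * h a x))"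
        by (simp add: power2_sum mean_add mean_cmult mult.assoc)
      also have "\<dots> = ?q * mean n (\<lambda>x. (g x)\<^sup>2) + (\<Sum>a\<in>UNIV. mean n (\<lambda>x. (h a x)\<^sup>2)) +
          2 * mean n (\<lambda>x. g x * (\<Sum>a\<in>UNIV. h a x))"
        by (simp add: sum.distrib mean_sum flip: sum_distrib_left) (simp add: sum_distrib_left mean_sum)
      finally show ?thesis
        using that by (simp add: add_divide_distrib)
    qed
    have F_eq: "F a = (\<lambda>x. u x + v a x)" for a
      by (simp add: v_def)
    have infl_lt: "influence (Suc n) i f = influence n i u + (\<Sum>a\<in>UNIV. influence n i (v a)) / ?q"
      if "i < n" for i
    proof -
      have "restr n a (\<lambda>x. (f x - line_avg i f x)\<^sup>2) = (\<lambda>x. (F a x - line_avg i (F a) x)\<^sup>2)" for a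
        using that fun_cong[OF restr_line_avg[of i n a f]] by (simp add: F_def restr_def)
      moreover have "(\<lambda>x. (F a x - line_avg i (F a) x)\<^sup>2) = (\<lambda>x. (U i x + V i a x)\<^sup>2)" for a
        unfolding U_def V_def v_def line_avg_diff by simp
      ultimately have "influence (Suc n) i f = (\<Sum>a\<in>UNIV. mean n (\<lambda>x. (U i x + V i a x)\<^sup>2)) / ?q"
        by (simp add: influence_def)
      also have "(\<Sum>a\<in>UNIV. mean n (\<lambda>x. (U i x + V i a x)\<^sup>2)) / ?q =
          mean n (\<lambda>x. (U i x)\<^sup>2) + (\<Sum>a\<in>UNIV. mean n (\<lambda>x. (V i a x)\<^sup>2)) / ?q"
        by (rule average_sq) (rule sum_V)
      finally show ?thesis
        by (simp add: influence_def U_def V_def)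
    qed
    define N where "N = (\<Sum>a\<in>UNIV. mean n (\<lambda>x. (v a x)\<^sup>2)) / ?q"
    have infl_n: "influence (Suc n) n f = N"
    proof -
      have "restr n a (\<lambda>x. (f x - line_avg n f x)\<^sup>2) = (\<lambda>x. (v a x)\<^sup>2)" for a
        by (simp add: restr_def v_def F_def u_def line_avg_def)
      then show ?thesis
        by (simp add: influence_def N_def)
    qed
    have mean_sq: "mean (Suc n) (\<lambda>x. (f x)\<^sup>2) = mean n (\<lambda>x. (u x)\<^sup>2) + N"
    proof -
      have "mean (Suc n) (\<lambda>x. (f x)\<^sup>2) = (\<Sum>a\<in>UNIV. mean n (\<lambda>x. (F a x)\<^sup>2)) / ?q"
        by (simp add: F_def restr_def)
      then show ?thesis
        unfolding F_eq N_def average_sq[of v u, OF sum_v] .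
    qed
    have mean_f: "mean (Suc n) f = mean n u"
      unfolding u_eq by (simp only: mean_cmult mean_sum) (simp add: F_def)
    \<comment> \<open>The induction hypothesis for \<open>v a\<close> is used with the squared mean
      discarded. Direction \<open>n\<close> contributes one more \<open>N\<close>, giving the factor
      \<open>d' + 1 = d\<close>.\<close>
    have "(\<Sum>i<n. influence n i (v a)) \<le> real d' * mean n (\<lambda>x. (v a x)\<^sup>2)" for a
      using Suc.IH[OF v_low, of a] by (rule order.trans) (simp add: mult_left_mono)
    then have "(\<Sum>a\<in>UNIV. \<Sum>i<n. influence n i (v a)) / ?q \<le> (\<Sum>a\<in>UNIV. real d' * mean n (\<lambda>x. (v a x)\<^sup>2)) / ?q"
      by (intro divide_right_mono sum_mono) auto
    also have "\<dots> = real d' * N"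
      by (simp add: N_def flip: sum_distrib_left)
    finally have v_bound: "(\<Sum>i<n. (\<Sum>a\<in>UNIV. influence n i (v a)) / ?q) \<le> real d' * N"
      by (subst (asm) sum.swap) (simp add: sum_divide_distrib)
    have "(\<Sum>i<Suc n. influence (Suc n) i f) =
        (\<Sum>i<n. influence n i u) + (\<Sum>i<n. (\<Sum>a\<in>UNIV. influence n i (v a)) / ?q) + N"
      by (simp add: infl_lt infl_n sum.distrib)
    also have "\<dots> \<le> real d * (mean n (\<lambda>x. (u x)\<^sup>2) - (mean n u)\<^sup>2) + real d' * N + N"
      using Suc.IH[OF u_low] v_bound by simp
    also have "\<dots> = real d * (mean (Suc n) (\<lambda>x. (f x)\<^sup>2) - (mean (Suc n) f)\<^sup>2)"
      unfolding mean_sq mean_f Suc by (simp add: algebra_simps)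
    finally show ?thesis .
  qed
qed

section \<open>Local degrees and weights of relevant variables\<close>

definition relevant :: "nat \<Rightarrow> ((nat \<Rightarrow> 'a) \<Rightarrow> real) \<Rightarrow> bool" where
  "relevant i f \<longleftrightarrow> (\<exists>a b x. diff i a b f x \<noteq> 0)"

text \<open>One exponent serves all pairs of values. The least one exists when \<open>f\<close> lies
  in some \<open>low n d\<close>, by \<open>low_diff\<close>.\<close>

definition local_degree :: "nat \<Rightarrow> nat \<Rightarrow> ((nat \<Rightarrow> 'a) \<Rightarrow> real) \<Rightarrow> nat" where
  "local_degree n i f = (LEAST k. \<forall>a b. diff i a b f \<in> low n k)"

definition weight_sum :: "nat \<Rightarrow> nat set \<Rightarrow> ((nat \<Rightarrow> 'a::finite) \<Rightarrow> real) \<Rightarrow> real" where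
  "weight_sum n T f = (\<Sum>i\<in>{i\<in>T. relevant i f}. 1 / real CARD('a) ^ local_degree n i f)"

definition boolean :: "((nat \<Rightarrow> 'a) \<Rightarrow> real) \<Rightarrow> bool" where
  "boolean f \<longleftrightarrow> (\<forall>x. f x \<in> {0, 1})"

lemma local_degree_le: "(\<And>a b. diff i a b f \<in> low n k) \<Longrightarrow> local_degree n i f \<le> k"
  unfolding local_degree_def by (rule Least_le) blast

lemma local_degree_le_low: "f \<in> low n d \<Longrightarrow> local_degree n i f \<le> d - 1"
  by (intro local_degree_le low_diff)

lemma diff_local_degree: "f \<in> low n d \<Longrightarrow> diff i a b f \<in> low n (local_degree n i f)"
  using LeastI[of "\<lambda>k. \<forall>a b. diff i a b f \<in> low n k" "d - 1"] low_diff[of f n d]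
  unfolding local_degree_def by blast

text \<open>Up to scaling, the variance of a nonconstant 0-1 function on \<open>k\<close> points is
  least when one of the values occurs only once.\<close>

lemma product_ge:
  fixes m k :: nat
  assumes "0 < m" "m < k"
  shows "real k - 1 \<le> real m * (real k - real m)"
proof -
  have "0 \<le> (real m - 1) * (real k - real m - 1)"
    using assms by (intro mult_nonneg_nonneg) auto
  then show ?thesis
    by (simp add: algebra_simps)
qed

text \<open>On a line where some difference is nonzero, \<open>f\<close> takes both values, so its
  variance there is at least \<open>(q - 1) / q^2\<close>; such lines have density at least that
  given by \<open>nonzero_density\<close>.\<close>

lemma influence_ge:
  fixes f :: "(nat \<Rightarrow> 'a::finite) \<Rightarrow> real"
  assumes "f \<in> low n d" "boolean f" "relevant i f" "i < n"
  shows "(real CARD('a) - 1) / (real CARD('a))\<^sup>2 / real CARD('a) ^ local_degree n i f \<le> influence n i f"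
proof -
  let ?q = "real CARD('a)"
  let ?h = "\<lambda>x. (f x - line_avg i f x)\<^sup>2"
  obtain a b x0 where ab: "diff i a b f x0 \<noteq> 0"
    using assms(3) unfolding relevant_def by blast
  have pointwise: "(?q - 1) / ?q\<^sup>2 * (if diff i a b f x \<noteq> 0 then 1 else 0) \<le> line_avg i ?h x" for x
  proof (cases "diff i a b f x = 0")
    case True
    then show ?thesis
      by (simp add: line_avg_def sum_nonneg)
  next
    case False
    \<comment> \<open>\<open>m\<close> counts the ones on the line through \<open>x\<close>; the
      variance on the line is \<open>m * (q - m) / q^2\<close>.\<close>
    define A where "A = {c. f (x(i := c)) = 1}"
    define m where "m = card A"
    have f01: "f (x(i := c)) = (if c \<in> A then 1 else 0)" for c
      using assms(2) unfolding boolean_def A_def by fastforce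
    have sumf: "(\<Sum>c\<in>UNIV. f (x(i := c))) = m"
      unfolding f01 m_def by (simp add: sum.If_cases)
    have "a \<in> A \<longleftrightarrow> b \<notin> A"
      using False unfolding diff_def f01 by (auto split: if_splits)
    then have "A \<noteq> {}" "A \<noteq> UNIV"
      by auto
    then have m: "0 < m" "m < CARD('a)"
      unfolding m_def by (simp_all add: card_gt_0_iff psubset_card_mono psubset_eq)
    have "line_avg i ?h x = (\<Sum>c\<in>UNIV. (f (x(i := c)) - m / ?q)\<^sup>2) / ?q"
      by (simp add: line_avg_def sumf)
    also have "(\<Sum>c\<in>UNIV. (f (x(i := c)) - m / ?q)\<^sup>2) =
        (\<Sum>c\<in>UNIV. f (x(i := c)) * (1 - 2 * (m / ?q)) + (m / ?q)\<^sup>2)"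
      by (intro sum.cong) (auto simp: f01 power2_eq_square algebra_simps)
    also have "\<dots> = m * (1 - 2 * (m / ?q)) + ?q * (m / ?q)\<^sup>2"
      by (simp add: sum.distrib sumf flip: sum_distrib_right)
    also have "\<dots> = m * (?q - m) / ?q"
      by (simp add: field_simps power2_eq_square)
    finally have "line_avg i ?h x = m * (?q - m) / ?q\<^sup>2"
      by (simp add: power2_eq_square)
    moreover have "?q - 1 \<le> m * (?q - m)"
      using product_ge[OF m] by simp
    ultimately show ?thesis
      using False by (simp add: divide_right_mono)
  qed
  have "1 / ?q ^ local_degree n i f \<le> mean n (\<lambda>x. if diff i a b f x \<noteq> 0 then 1 else 0)"
    using nonzero_density[OF diff_local_degree[OF assms(1)] ab] .
  then have "(?q - 1) / ?q\<^sup>2 * (1 / ?q ^ local_degree n i f) \<le>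
      (?q - 1) / ?q\<^sup>2 * mean n (\<lambda>x. if diff i a b f x \<noteq> 0 then 1 else 0)"
    by (intro mult_left_mono) (auto simp: Suc_le_eq)
  \<comment> \<open>The pointwise bound concerns the line average of \<open>?h\<close>, which has
    the same mean as \<open>?h\<close>.\<close>
  also have "\<dots> \<le> mean n (line_avg i ?h)"
    unfolding mean_cmult[symmetric] by (intro mean_mono pointwise)
  also have "\<dots> = influence n i f"
    unfolding influence_def using assms(4) by (rule mean_line_avg)
  finally show ?thesis
    by simp
qed

text \<open>Combines the lower bound for each influence with the upper bound for their sum. For 0-1
  values of mean \<open>p\<close> the variance is \<open>p - p^2\<close>, at most
  \<open>1 / 4\<close>.\<close>

lemma weight_sum_le_influence:
  fixes f :: "(nat \<Rightarrow> 'a::finite) \<Rightarrow> real"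
  assumes "f \<in> low n d" "boolean f" "CARD('a) \<ge> 2"
  shows "weight_sum n {..<n} f / CARD('a) \<le> real d * real CARD('a) / (4 * (real CARD('a) - 1))"
proof -
  let ?q = "real CARD('a)"
  have nonneg: "0 \<le> influence n i f" for i
    unfolding influence_def by (intro mean_nonneg) auto
  have "(?q - 1) / ?q\<^sup>2 * weight_sum n {..<n} f \<le> (\<Sum>i\<in>{i\<in>{..<n}. relevant i f}. influence n i f)"
    unfolding weight_sum_def sum_distrib_left
    using influence_ge[OF assms(1,2)] by (intro sum_mono) auto
  also have "\<dots> \<le> (\<Sum>i<n. influence n i f)"
    using nonneg by (intro sum_mono2) auto
  also have "\<dots> \<le> d * (mean n (\<lambda>x. (f x)\<^sup>2) - (mean n f)\<^sup>2)"
    by (rule sum_influence_le[OF assms(1)])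
  also have "(\<lambda>x. (f x)\<^sup>2) = f"
  proof
    fix x
    have "f x \<in> {0, 1}"
      using assms(2) unfolding boolean_def by blast
    then show "(f x)\<^sup>2 = f x"
      by auto
  qed
  also have "real d * (mean n f - (mean n f)\<^sup>2) \<le> d * (1 / 4)"
  proof (intro mult_left_mono)
    have "0 \<le> (mean n f - 1 / 2)\<^sup>2"
      by simp
    then show "mean n f - (mean n f)\<^sup>2 \<le> 1 / 4"
      by (simp add: power2_eq_square algebra_simps)
  qed auto
  finally show ?thesis
    using assms(3) by (simp add: field_simps power2_eq_square)
qed

section \<open>Restrictions and minimal representations\<close>

text \<open>The value 0 at irrelevant variables lets sums run over a fixed index set, so that
  restrictions with different relevant variables can be averaged.\<close>

definition local_weight :: "nat \<Rightarrow> ((nat \<Rightarrow> 'a::finite) \<Rightarrow> real) \<Rightarrow> nat \<Rightarrow> real" where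
  "local_weight n f i = (if relevant i f then 1 / real CARD('a) ^ local_degree n i f else 0)"

lemma weight_sum_eq: "finite T \<Longrightarrow> weight_sum n T f = (\<Sum>i\<in>T. local_weight n f i)"
  unfolding weight_sum_def local_weight_def by (rule sum.inter_filter)

lemma local_weight_nonneg: "0 \<le> local_weight n f i"
  by (simp add: local_weight_def)

lemma local_weight_ge:
  assumes "relevant i g" "local_degree n i g \<le> k"
  shows "1 / real CARD('a::finite) ^ k \<le> local_weight n (g :: (nat \<Rightarrow> 'a) \<Rightarrow> real) i"
  using assms by (auto simp: local_weight_def intro!: divide_left_mono power_increasing simp: Suc_le_eq)

lemma diff_restr: "i \<noteq> j \<Longrightarrow> diff i b c (restr j a f) = restr j a (diff i b c f)"
  by (auto simp: diff_def restr_def fun_upd_twist)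

text \<open>If some restriction makes \<open>i\<close> irrelevant, then every difference in direction \<open>i\<close> of any other restriction is a second difference of \<open>f\<close>, and the drop in degree outweighs the loss of the factor \<open>q\<close>.\<close>

lemma local_weight_restr:
  fixes f :: "(nat \<Rightarrow> 'a::finite) \<Rightarrow> real"
  assumes "f \<in> low n d" "i \<noteq> j"
  shows "local_weight n f i \<le> (\<Sum>a\<in>UNIV. local_weight n (restr j a f) i) / CARD('a)"
proof (cases "relevant i f")
  case False
  then show ?thesis
    by (simp add: local_weight_def[of n f] sum_nonneg local_weight_nonneg)
next
  case True
  let ?q = "real CARD('a)"
  let ?k = "local_degree n i f"
  note D = diff_local_degree[OF assms(1), of i]
  show ?thesis
  proof (cases "\<forall>a. relevant i (restr j a f)")
    case True
    have "local_weight n f i \<le> local_weight n (restr j a f) i" for a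
    proof -
      have "local_degree n i (restr j a f) \<le> ?k"
        by (intro local_degree_le) (simp add: diff_restr[OF assms(2)] low_restr[OF D])
      then show ?thesis
        using True local_weight_ge[of i "restr j a f" n ?k] \<open>relevant i f\<close>
        unfolding local_weight_def[of n f] by auto
    qed
    then have "(\<Sum>a::'a\<in>UNIV. local_weight n f i) / ?q \<le> (\<Sum>a\<in>UNIV. local_weight n (restr j a f) i) / ?q"
      by (intro divide_right_mono sum_mono) auto
    then show ?thesis
      by simp
  next
    case False
    then obtain a0 where a0: "\<not> relevant i (restr j a0 f)"
      by blast
    obtain b c x where x: "diff i b c f x \<noteq> 0"
      using \<open>relevant i f\<close> unfolding relevant_def by blast
    \<comment> \<open>Fixing \<open>j\<close> to its value at the witness \<open>x\<close> keeps the
      difference nonzero, so \<open>i\<close> stays relevant.\<close>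
    let ?g = "restr j (x j) f"
    have "diff i b c ?g x \<noteq> 0"
      using x by (simp add: diff_restr assms(2)) (simp add: restr_def)
    then have rel: "relevant i ?g"
      unfolding relevant_def by blast
    have eq: "diff i b c ?g = diff j (x j) a0 (diff i b c f)" for b c
      using a0 unfolding relevant_def diff_eq_restr[of j] diff_restr[OF assms(2), symmetric] by simp
    have "?k \<noteq> 0"
    proof
      assume "?k = 0"
      then have "diff i b c ?g = (\<lambda>_. 0)"
        unfolding eq using D[of b c] by (intro diff_low_0[of _ n]) simp
      with \<open>diff i b c ?g x \<noteq> 0\<close> show False
        by simp
    qed
    then obtain k where k: "?k = Suc k"
      using not0_implies_Suc by blast
    have "diff i b c f \<in> low n (Suc k)" for b c
      using D k by simp
    then have "local_degree n i ?g \<le> k"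
      by (intro local_degree_le) (simp add: eq diff_in_low)
    then have "1 / ?q ^ k \<le> local_weight n ?g i"
      using rel by (rule local_weight_ge[rotated])
    also have "\<dots> \<le> (\<Sum>a\<in>UNIV. local_weight n (restr j a f) i)"
      by (intro member_le_sum) (auto simp: local_weight_nonneg)
    finally have "1 / ?q ^ k / ?q \<le> (\<Sum>a\<in>UNIV. local_weight n (restr j a f) i) / ?q"
      by (intro divide_right_mono) auto
    then show ?thesis
      using \<open>relevant i f\<close> k by (simp add: local_weight_def[of n f] mult.commute)
  qed
qed

text \<open>The weight is at most the average over the values of \<open>j\<close>, and some value
  does at least as well as the average.\<close>

lemma weight_sum_restr:
  fixes f :: "(nat \<Rightarrow> 'a::finite) \<Rightarrow> real"
  assumes "f \<in> low n d" "j \<notin> T" "finite T"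
  obtains a where "weight_sum n T f \<le> weight_sum n T (restr j a f)"
proof -
  let ?q = "real CARD('a)"
  have "weight_sum n T f \<le> (\<Sum>i\<in>T. (\<Sum>a\<in>UNIV. local_weight n (restr j a f) i) / ?q)"
    unfolding weight_sum_eq[OF assms(3)] using assms(1,2) by (intro sum_mono local_weight_restr) auto
  also have "\<dots> = (\<Sum>a\<in>UNIV. weight_sum n T (restr j a f)) / ?q"
    unfolding weight_sum_eq[OF assms(3)] by (subst sum.swap) (simp add: sum_divide_distrib)
  finally have le: "?q * weight_sum n T f \<le> (\<Sum>a\<in>UNIV. weight_sum n T (restr j a f))"
    by (simp add: field_simps)
  have "\<exists>a. weight_sum n T f \<le> weight_sum n T (restr j a f)"
  proof (rule ccontr)
    assume "\<not> ?thesis"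
    then have "(\<Sum>a\<in>UNIV. weight_sum n T (restr j a f)) < (\<Sum>a::'a\<in>UNIV. weight_sum n T f)"
      by (intro sum_strict_mono) (auto simp: not_le)
    with le show False
      by simp
  qed
  with that show thesis
    by blast
qed

definition override :: "nat set \<Rightarrow> (nat \<Rightarrow> 'a) \<Rightarrow> ((nat \<Rightarrow> 'a) \<Rightarrow> real) \<Rightarrow> (nat \<Rightarrow> 'a) \<Rightarrow> real" where
  "override H \<alpha> f = (\<lambda>x. f (\<lambda>i. if i \<in> H then \<alpha> i else x i))"

lemma depends_on_override: "depends_on A f \<Longrightarrow> depends_on (A - H) (override H \<alpha> f)"
  unfolding depends_on_def override_def by auto

lemma low_override:
  assumes "f \<in> low n k"
  shows "override H \<alpha> f \<in> low n k"
proof (rule low_linear[where L = "override H \<alpha>", OF assms])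
  fix S :: "nat set" and c :: "(nat \<Rightarrow> 'a) \<Rightarrow> real"
  assume "finite S" "S \<subseteq> {..<n}" "card S \<le> k" "depends_on S c"
  then show "override H \<alpha> c \<in> low n k"
    by (intro low_junta[OF depends_on_override]) (auto intro: order.trans[OF card_mono])
qed (simp add: override_def)

lemma weight_sum_override:
  fixes f :: "(nat \<Rightarrow> 'a::finite) \<Rightarrow> real"
  assumes "f \<in> low n d" "finite T" "finite H" "H \<inter> T = {}"
  shows "\<exists>\<alpha>. weight_sum n T f \<le> weight_sum n T (override H \<alpha> f)"
  using assms(3,4)
proof (induction H)
  case empty
  then show ?case
    by (simp add: override_def)
next
  case (insert j H)
  then obtain \<alpha> where \<alpha>: "weight_sum n T f \<le> weight_sum n T (override H \<alpha> f)"
    by auto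
  obtain a where "weight_sum n T (override H \<alpha> f) \<le> weight_sum n T (restr j a (override H \<alpha> f))"
    using weight_sum_restr[OF low_override[OF assms(1)], of j T] insert.prems assms(2) by auto
  also have "restr j a (override H \<alpha> f) = override (insert j H) (\<alpha>(j := a)) f"
  proof -
    have "(\<lambda>i. if i \<in> H then \<alpha> i else (x(j := a)) i) = (\<lambda>i. if i \<in> insert j H then (\<alpha>(j := a)) i else x i)" for x
      using insert.hyps by auto
    then show ?thesis
      unfolding restr_def override_def by (simp only:)
  qed
  finally show ?case
    using \<alpha> by (meson order.trans)
qed

section \<open>Irredundant families of top-degree sets\<close>

definition small_sets :: "nat \<Rightarrow> nat \<Rightarrow> nat set set" where
  "small_sets n d = {S. S \<subseteq> {..<n} \<and> card S < d}"

text \<open>Smaller sets are free, so a \<open>d\<close>-set is redundant as soon as its junta can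
  be rewritten over smaller sets and the other \<open>d\<close>-sets; the arguments below contradict
  irredundancy in this way.\<close>

definition top_family :: "nat \<Rightarrow> nat \<Rightarrow> ((nat \<Rightarrow> 'a) \<Rightarrow> real) \<Rightarrow> nat set set \<Rightarrow> bool" where
  "top_family n d f \<T> \<longleftrightarrow> \<T> \<subseteq> {S. S \<subseteq> {..<n} \<and> card S = d} \<and>
     f \<in> spanned (\<T> \<union> small_sets n d) \<and> (\<forall>S\<in>\<T>. f \<notin> spanned ((\<T> - {S}) \<union> small_sets n d))"

lemma finite_small_sets [simp]: "finite (small_sets n d)"
  by (simp add: small_sets_def)

lemma ex_top_family:
  assumes "f \<in> low n d"
  shows "\<exists>\<T>. top_family n d f \<T>"
proof -
  define P where "P \<T> \<longleftrightarrow> \<T> \<subseteq> {S. S \<subseteq> {..<n} \<and> card S = d} \<and> f \<in> spanned (\<T> \<union> small_sets n d)" for \<T>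
  have "{S. S \<subseteq> {..<n} \<and> card S = d} \<union> small_sets n d = {S. S \<subseteq> {..<n} \<and> card S \<le> d}"
    by (auto simp: small_sets_def)
  then have "P {S. S \<subseteq> {..<n} \<and> card S = d}"
    using assms by (simp add: low_def P_def)
  from ex_has_least_nat[of P, OF this, of card] obtain \<T>
    where \<T>: "P \<T>" "\<forall>\<T>'. P \<T>' \<longrightarrow> card \<T> \<le> card \<T>'"
    by (elim exE conjE)
  have "f \<notin> spanned ((\<T> - {S}) \<union> small_sets n d)" if "S \<in> \<T>" for S
  proof
    have "finite \<T>"
      using \<T>(1) finite_low_family[of n "\<lambda>S. card S = d"] finite_subset unfolding P_def by blast
    assume "f \<in> spanned ((\<T> - {S}) \<union> small_sets n d)"
    then have "P (\<T> - {S})"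
      using \<T>(1) by (auto simp: P_def)
    with \<T>(2) have "card \<T> \<le> card (\<T> - {S})"
      by blast
    with that \<open>finite \<T>\<close> show False
      by (meson card_Diff1_less linorder_not_le)
  qed
  with \<T>(1) show ?thesis
    unfolding top_family_def P_def by blast
qed

lemma top_family_finite: "top_family n d f \<T> \<Longrightarrow> finite \<T>"
  unfolding top_family_def using finite_low_family[of n "\<lambda>S. card S = d"] finite_subset by blast

text \<open>If \<open>f\<close> were constant on the subcube through \<open>x\<close> in the
  directions \<open>S\<close>, the summand of \<open>S\<close> would be expressible through the
  other summands with their coordinates outside \<open>S\<close> frozen, hence through sets of size
  below \<open>d\<close>.\<close>

lemma top_family_nonconst:
  assumes "top_family n d f \<T>" "S \<in> \<T>" "d \<ge> 1"
  shows "\<exists>y. (\<forall>i. i \<notin> S \<longrightarrow> y i = x i) \<and> f y \<noteq> f x"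
proof (rule ccontr)
  assume const: "\<not> ?thesis"
  define mix where "mix z = (\<lambda>i. if i \<in> S then z i else x i)" for z
  have f_mix: "f (mix z) = f x" for z
  proof -
    have "\<forall>i. i \<notin> S \<longrightarrow> mix z i = x i"
      by (simp add: mix_def)
    with const show ?thesis
      by blast
  qed
  let ?\<F> = "\<T> \<union> small_sets n d"
  let ?\<G> = "(\<T> - {S}) \<union> small_sets n d"
  have fin: "finite ?\<F>" "finite ?\<G>"
    using top_family_finite[OF assms(1)] by auto
  have S: "S \<subseteq> {..<n}" "card S = d"
    using assms(1,2) unfolding top_family_def by auto
  then have "S \<in> ?\<F>" "S \<notin> small_sets n d" "finite S"
    using assms(2) finite_subset by (auto simp: small_sets_def)
  then have G: "?\<F> - {S} = ?\<G>"
    by auto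
  obtain c where c: "\<forall>T\<in>?\<F>. depends_on T (c T)" "f = (\<lambda>x. \<Sum>T\<in>?\<F>. c T x)"
    using assms(1) unfolding top_family_def spanned_def by auto
  have f_split: "f z = c S z + (\<Sum>T\<in>?\<G>. c T z)" for z
    unfolding G[symmetric] by (subst c(2)) (rule sum.remove[OF fin(1) \<open>S \<in> ?\<F>\<close>])
  have c_S: "c S z = f x - (\<Sum>T\<in>?\<G>. c T (mix z))" for z
  proof -
    have "c S (mix z) = c S z"
      using c(1) \<open>S \<in> ?\<F>\<close> by (intro depends_onD[of S "c S"]) (auto simp: mix_def)
    then show ?thesis
      using f_split[of "mix z"] f_mix[of z] by simp
  qed
  \<comment> \<open>A constant is a junta on the empty set, which is a small set because
    \<open>d\<close> is at least 1.\<close>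
  have "(\<lambda>_. f x) \<in> spanned ?\<G>"
    using fin(2) assms(3) by (intro spanned_junta[where A = "{}" and S = "{}"]) (auto simp: depends_on_def small_sets_def)
  moreover have "(\<lambda>z. \<Sum>T\<in>?\<G>. c T (mix z)) \<in> spanned ?\<G>"
  proof (rule spanned_sum, rule spanned_junta[OF fin(2)])
    fix T assume that: "T \<in> ?\<G>"
    have T: "T \<noteq> S" "card T \<le> d" "finite T"
      using that assms(1) finite_subset[of T "{..<n}"] \<open>S \<notin> small_sets n d\<close>
      unfolding top_family_def by (auto simp: small_sets_def)
    \<comment> \<open>Otherwise \<open>S\<close> would be contained in \<open>T\<close>, and
      \<open>card T \<le> d\<close> would force equality.\<close>
    have "card (S \<inter> T) < d"
    proof -
      have "S \<inter> T \<noteq> S"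
        using T S \<open>finite S\<close> by (metis card_seteq inf.orderE inf.cobounded2)
      then show ?thesis
        using S \<open>finite S\<close> by (metis inf.cobounded1 psubsetI psubset_card_mono)
    qed
    then show "S \<inter> T \<in> ?\<G>"
      using S by (auto simp: small_sets_def)
    have "depends_on T (c T)"
      using c(1) that by auto
    then show "depends_on (S \<inter> T) (\<lambda>z. c T (mix z))"
      unfolding depends_on_def mix_def by auto
  qed simp
  ultimately have "(\<lambda>z. f x - (\<Sum>T\<in>?\<G>. c T (mix z))) \<in> spanned ?\<G>"
    by (intro spanned_diff)
  then have "c S \<in> spanned ?\<G>"
    unfolding c_S[symmetric] .
  moreover have "(\<lambda>z. \<Sum>T\<in>?\<G>. c T z) \<in> spanned ?\<G>"
  proof (rule spanned_sum)
    fix T assume "T \<in> ?\<G>"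
    then show "c T \<in> spanned ?\<G>"
      using c(1) fin(2) by (intro spanned_junta[where A = T and S = T]) auto
  qed
  ultimately have "(\<lambda>z. c S z + (\<Sum>T\<in>?\<G>. c T z)) \<in> spanned ?\<G>"
    by (rule spanned_add)
  then have "f \<in> spanned ?\<G>"
    unfolding f_split[symmetric] .
  then show False
    using assms(1,2) unfolding top_family_def by blast
qed

lemma low_indicator_mult:
  assumes "f \<in> low n k" "i < n"
  shows "(\<lambda>x. if x i = b then f x else 0) \<in> low n (Suc k)"
proof (rule low_linear[where L = "\<lambda>f x. if x i = b then f x else 0", OF assms(1)])
  fix S :: "nat set" and c :: "(nat \<Rightarrow> 'a) \<Rightarrow> real"
  assume S: "finite S" "S \<subseteq> {..<n}" "card S \<le> k" "depends_on S c"
  have "depends_on (insert i S) (\<lambda>x. if x i = b then c x else 0)"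
    using S(4) unfolding depends_on_def by auto
  then show "(\<lambda>x. if x i = b then c x else 0) \<in> low n (Suc k)"
    using S assms(2) by (intro low_junta[where A = "insert i S"]) (auto simp: card_insert_if)
qed auto

text \<open>\<open>f\<close> equals \<open>restr i a f\<close> plus, over all \<open>b\<close>, the
  difference \<open>diff i b a f\<close> on the points with \<open>x i = b\<close>. Restricting
  \<open>i\<close> shrinks \<open>S\<close>, and were all differences of degree below
  \<open>d - 1\<close>, the other terms would have degree below \<open>d\<close>; so
  \<open>S\<close> would be redundant.\<close>

lemma top_family_local_degree:
  fixes f :: "(nat \<Rightarrow> 'a::finite) \<Rightarrow> real"
  assumes "top_family n d f \<T>" "S \<in> \<T>" "i \<in> S" "f \<in> low n d"
  shows "d - 1 \<le> local_degree n i f"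
proof (rule ccontr)
  let ?k = "local_degree n i f"
  let ?\<G> = "(\<T> - {S}) \<union> small_sets n d"
  assume "\<not> ?thesis"
  then have k: "Suc ?k < d"
    by simp
  have fin: "finite ?\<G>"
    using top_family_finite[OF assms(1)] by auto
  have S: "S \<subseteq> {..<n}" "card S = d" "finite S"
    using assms(1,2) finite_subset unfolding top_family_def by auto
  obtain a where "a \<in> (UNIV :: 'a set)"
    by blast
  have "restr i a f \<in> spanned ?\<G>"
  proof (rule spanned_linear[where L = "restr i a" and \<F> = "\<T> \<union> small_sets n d"])
    fix T and c :: "(nat \<Rightarrow> 'a) \<Rightarrow> real"
    assume T: "T \<in> \<T> \<union> small_sets n d" "depends_on T c"
    show "restr i a c \<in> spanned ?\<G>"
    proof (cases "T = S")
      case True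
      have "card (S - {i}) < d"
        using card_Diff1_less[OF S(3) assms(3)] S(2) by simp
      then have "S - {i} \<in> ?\<G>"
        using S(1) by (auto simp: small_sets_def)
      then show ?thesis
        using depends_on_restr[OF T(2)] True fin by (intro spanned_junta) auto
    next
      case False
      then show ?thesis
        using T depends_on_restr[OF T(2)] fin by (intro spanned_junta[where S = T]) auto
    qed
  qed (use assms(1) in \<open>auto simp: top_family_def restr_def\<close>)
  moreover have "(\<lambda>x. \<Sum>b\<in>UNIV. if x i = b then diff i b a f x else 0) \<in> spanned ?\<G>"
  proof (rule spanned_sum)
    fix b
    have "(\<lambda>x. if x i = b then diff i b a f x else 0) \<in> low n (Suc ?k)"
      using diff_local_degree[OF assms(4)] S(1) assms(3) by (intro low_indicator_mult) auto
    then show "(\<lambda>x. if x i = b then diff i b a f x else 0) \<in> spanned ?\<G>"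
      unfolding low_def by (rule spanned_mono[OF _ fin]) (use k in \<open>force simp: small_sets_def\<close>)
  qed
  ultimately have "(\<lambda>x. restr i a f x + (\<Sum>b\<in>UNIV. if x i = b then diff i b a f x else 0)) \<in> spanned ?\<G>"
    by (rule spanned_add)
  also have "(\<lambda>x. restr i a f x + (\<Sum>b\<in>UNIV. if x i = b then diff i b a f x else 0)) = f"
    by (simp add: restr_def diff_def)
  finally show False
    using assms(1,2) unfolding top_family_def by blast
qed

text \<open>Every top set loses an element to \<open>H\<close>, and the remaining sets already have
  fewer than \<open>d\<close> elements.\<close>

lemma low_override_hitting:
  assumes "top_family n d f \<T>" "\<And>S. S \<in> \<T> \<Longrightarrow> S \<inter> H \<noteq> {}" "d \<ge> 1"
  shows "override H \<alpha> f \<in> low n (d - 1)"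
  unfolding low_def
proof (rule spanned_linear[where L = "override H \<alpha>" and \<F> = "\<T> \<union> small_sets n d"])
  fix T and c :: "(nat \<Rightarrow> 'a) \<Rightarrow> real"
  assume T: "T \<in> \<T> \<union> small_sets n d" "depends_on T c"
  have T': "T \<subseteq> {..<n}"
    using T assms(1) by (auto simp: small_sets_def top_family_def)
  then have "finite T"
    using finite_subset by auto
  have "card (T - H) < d"
  proof (cases "T \<in> \<T>")
    case True
    then have "T - H \<subset> T" "card T = d"
      using assms(1,2) by (auto simp: top_family_def)
    then show ?thesis
      using \<open>finite T\<close> psubset_card_mono by blast
  next
    case False
    then have "card T < d"
      using T by (auto simp: small_sets_def)
    then show ?thesis
      using \<open>finite T\<close> by (meson Diff_subset card_mono order.strict_trans1)
  qed
  then show "override H \<alpha> c \<in> spanned {S. S \<subseteq> {..<n} \<and> card S \<le> d - 1}"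
    using T' depends_on_override[OF T(2)] by (intro spanned_junta[where A = "T - H" and S = "T - H"]) auto
qed (use assms(1) in \<open>auto simp: top_family_def override_def\<close>)

text \<open>A disjoint subfamily of greatest cardinality works, since a set missing its union could
  be added; nonemptiness ensures that such a set is not already a member.\<close>

lemma maximal_disjoint_subfamily:
  assumes "finite \<T>" "{} \<notin> \<T>"
  obtains \<D> where "\<D> \<subseteq> \<T>" "disjoint \<D>" "\<And>S. S \<in> \<T> \<Longrightarrow> S \<inter> \<Union>\<D> \<noteq> {}"
proof -
  let ?P = "\<lambda>\<D>. \<D> \<subseteq> \<T> \<and> disjoint \<D>"
  have "?P {}"
    by simp
  moreover have "\<forall>\<D>. ?P \<D> \<longrightarrow> card \<D> < Suc (card \<T>)"
    using assms(1) by (simp add: card_mono less_Suc_eq_le)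
  ultimately obtain \<D> where \<D>: "?P \<D>" "\<And>\<D>'. ?P \<D>' \<Longrightarrow> card \<D>' \<le> card \<D>"
    using ex_has_greatest_nat[of ?P "{}" card "Suc (card \<T>)"] by blast
  have "S \<inter> \<Union>\<D> \<noteq> {}" if "S \<in> \<T>" for S
  proof
    assume *: "S \<inter> \<Union>\<D> = {}"
    have "S \<notin> \<D>"
    proof
      assume "S \<in> \<D>"
      then have "S = {}"
        using * by blast
      with that assms(2) show False
        by simp
    qed
    moreover have "?P (insert S \<D>)"
      using \<D>(1) that * by (auto simp: disjoint_def)
    then have "card (insert S \<D>) \<le> card \<D>"
      by (rule \<D>(2))
    moreover have "finite \<D>"
      using \<D>(1) assms(1) finite_subset by blast
    ultimately show False
      by simp
  qed
  with \<D>(1) that show thesis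
    by blast
qed

section \<open>Polynomials bounded at the nodes \<open>0, 1, 2 j\<^sup>2\<close>\<close>

text \<open>The sum is the coefficient of degree \<open>card X - 1\<close> in the Lagrange
  interpolant of \<open>p\<close>, which is \<open>p\<close> itself.\<close>

lemma divided_difference_zero:
  fixes p :: "real poly"
  assumes "finite X" "Suc (degree p) < card X"
  shows "(\<Sum>t\<in>X. poly p t / (\<Prod>s\<in>X - {t}. t - s)) = 0"
proof -
  define B where "B t = (\<Prod>s\<in>X - {t}. [:- s, 1:])" for t :: real
  define L where "L = (\<Sum>t\<in>X. smult (poly p t / (\<Prod>s\<in>X - {t}. t - s)) (B t))"
  have deg_B: "degree (B t) = card X - 1" if "t \<in> X" for t
    unfolding B_def using assms(1) that by (subst degree_prod_eq_sum_degree) auto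
  have "coeff (B t) (degree (B t)) = 1" for t
    unfolding B_def by (simp add: lead_coeff_prod)
  then have coeff_B: "coeff (B t) (card X - 1) = 1" if "t \<in> X" for t
    using deg_B[OF that] by metis
  have "p = L"
  proof (rule poly_eqI_degree[where A = X])
    fix x assume x: "x \<in> X"
    have "poly L x = (\<Sum>t\<in>X. if t = x then poly p t else 0)"
      unfolding L_def poly_sum
    proof (intro sum.cong refl)
      fix t assume t: "t \<in> X"
      show "poly (smult (poly p t / (\<Prod>s\<in>X - {t}. t - s)) (B t)) x = (if t = x then poly p t else 0)"
      proof (cases "t = x")
        case True
        have "(\<Prod>s\<in>X - {x}. x - s) \<noteq> 0"
          using assms(1) by auto
        then show ?thesis
          using True by (simp add: B_def poly_prod)
      next
        case False
        then have "poly (B t) x = 0"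
          using x assms(1) by (auto simp: B_def poly_prod)
        then show ?thesis
          using False by simp
      qed
    qed
    then show "poly p x = poly L x"
      using x assms(1) by simp
  next
    show "degree p < card X"
      using assms(2) by simp
    have "degree L \<le> card X - 1"
      unfolding L_def using deg_B by (intro degree_sum_le[OF assms(1)] order.trans[OF degree_smult_le]) simp
    then show "degree L < card X"
      using assms(2) by simp
  qed
  then have "coeff L (card X - 1) = 0"
    using assms(2) by (metis coeff_eq_0 less_diff_conv Suc_eq_plus1)
  moreover have "coeff L (card X - 1) = (\<Sum>t\<in>X. poly p t / (\<Prod>s\<in>X - {t}. t - s))"
    unfolding L_def coeff_sum by (intro sum.cong) (simp_all only: coeff_smult coeff_B mult_1_right)
  ultimately show ?thesis
    by simp
qed

section \<open>Products and sums over squares\<close>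

lemma fact_mult_le: "j \<le> d \<Longrightarrow> fact d * fact d \<le> (fact (d - j) * fact (d + j) :: real)"
proof (induction j)
  case (Suc j)
  have "fact (d - j) = real (d - j) * fact (d - Suc j)"
    using Suc.prems by (metis Suc_diff_le diff_Suc_Suc fact_Suc le_add_diff_inverse2 less_eq_Suc_le Suc_diff_Suc of_nat_fact of_nat_mult)
  then have "fact (d - j) * fact (d + j) = real (d - j) * (fact (d - Suc j) * fact (d + j) :: real)"
    by simp
  also have "\<dots> \<le> real (d + Suc j) * (fact (d - Suc j) * fact (d + j))"
    by (intro mult_right_mono) auto
  also have "\<dots> = fact (d - Suc j) * fact (d + Suc j)"
    by simp
  finally show ?case
    using Suc by (meson Suc_leD order.trans)
qed simp

lemma prod_add_fact: "(\<Prod>i = 1..m. real (j + i)) * fact j = fact (j + m)"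
proof (induction m)
  case (Suc m)
  have "(\<Prod>i = 1..Suc m. real (j + i)) * fact j = (\<Prod>i = 1..m. real (j + i)) * fact j * real (j + Suc m)"
    by simp
  also have "\<dots> = fact (j + Suc m)"
    unfolding Suc.IH by (simp add: mult.commute)
  finally show ?case .
qed simp

text \<open>Factoring \<open>i^2 - j^2\<close> as \<open>(i - j) * (i + j)\<close> turns the product
  into factorials. The induction starts at \<open>d = j\<close>.\<close>

lemma prod_square_ratio:
  assumes "1 \<le> j" "j \<le> d"
  shows "(\<Prod>i\<in>{1..d} - {j}. (real i)\<^sup>2 / \<bar>(real i)\<^sup>2 - (real j)\<^sup>2\<bar>) * (fact (d - j) * fact (d + j)) =
    2 * (fact d)\<^sup>2"
  using assms(2)
proof (induction d rule: dec_induct)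
  case base
  obtain m where m: "j = Suc m"
    using assms(1) by (cases j) auto
  have set: "{1..j} - {j} = {1..m}"
    by (auto simp: m)
  have "(\<Prod>i = 1..m. (real i)\<^sup>2 / \<bar>(real i)\<^sup>2 - (real j)\<^sup>2\<bar>) =
      (\<Prod>i = 1..m. real i * real i / (real (j - i) * real (j + i)))"
  proof (intro prod.cong refl)
    fix i assume "i \<in> {1..m}"
    then have i: "real i < real j"
      by (simp add: m)
    then have "(real i)\<^sup>2 < (real j)\<^sup>2"
      by (intro power_strict_mono) auto
    then have "\<bar>(real i)\<^sup>2 - (real j)\<^sup>2\<bar> = real (j - i) * real (j + i)"
      using i by (simp add: of_nat_diff power2_eq_square algebra_simps)
    then show "(real i)\<^sup>2 / \<bar>(real i)\<^sup>2 - (real j)\<^sup>2\<bar> = real i * real i / (real (j - i) * real (j + i))"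
      by (simp add: power2_eq_square)
  qed
  also have "\<dots> = (\<Prod>i = 1..m. real i) * (\<Prod>i = 1..m. real i) /
      ((\<Prod>i = 1..m. real (j - i)) * (\<Prod>i = 1..m. real (j + i)))"
    by (simp add: prod.distrib prod_dividef)
  also have "(\<Prod>i = 1..m. real (j - i)) = (\<Prod>i = 1..m. real i)"
    by (subst prod.atLeastAtMost_rev) (auto intro!: prod.cong simp: m)
  also have "(\<Prod>i = 1..m. real i) = fact m"
    by (simp add: fact_prod)
  also have "(\<Prod>i = 1..m. real (j + i)) = fact (j + m) / fact j"
    using prod_add_fact[of j m] by (simp add: field_simps)
  finally have "(\<Prod>i\<in>{1..j} - {j}. (real i)\<^sup>2 / \<bar>(real i)\<^sup>2 - (real j)\<^sup>2\<bar>) = fact m * fact j / fact (j + m)"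
    unfolding set by simp
  \<comment> \<open>Here \<open>j + m = 2 * j - 1\<close>; the factor 2 comes from
    \<open>fact (2 * j) = 2 * j * fact (2 * j - 1)\<close>.\<close>
  then show ?case
    by (simp add: m power2_eq_square)
next
  case (step d)
  have set: "{1..Suc d} - {j} = insert (Suc d) ({1..d} - {j})"
    using step.hyps by auto
  have cancel: "x / (a * b) * ((a * F) * (b * G)) = x * (F * G)" if "a \<noteq> 0" "b \<noteq> 0" for x a b F G :: real
    using that by simp
  have pos: "(real j)\<^sup>2 < (real (Suc d))\<^sup>2"
    using step.hyps by (intro power_strict_mono) auto
  have "\<bar>(real (Suc d))\<^sup>2 - (real j)\<^sup>2\<bar> = real (Suc d - j) * real (Suc d + j)"
    using pos step.hyps by (simp only: of_nat_diff) (simp add: power2_eq_square algebra_simps)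
  moreover have "fact (Suc d - j) = real (Suc d - j) * fact (d - j)"
    using step.hyps by (simp add: Suc_diff_le)
  moreover have "fact (Suc d + j) = real (Suc d + j) * fact (d + j)"
    by simp
  moreover have "real (Suc d - j) \<noteq> 0" "real (Suc d + j) \<noteq> 0"
    using step.hyps by auto
  ultimately have factor: "(real (Suc d))\<^sup>2 / \<bar>(real (Suc d))\<^sup>2 - (real j)\<^sup>2\<bar> * (fact (Suc d - j) * fact (Suc d + j)) =
      (real (Suc d))\<^sup>2 * (fact (d - j) * fact (d + j) :: real)"
    by (simp only: cancel not_False_eq_True)
  let ?P = "\<Prod>i\<in>{1..d} - {j}. (real i)\<^sup>2 / \<bar>(real i)\<^sup>2 - (real j)\<^sup>2\<bar>"
  have "(\<Prod>i\<in>{1..Suc d} - {j}. (real i)\<^sup>2 / \<bar>(real i)\<^sup>2 - (real j)\<^sup>2\<bar>) =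
      ?P * ((real (Suc d))\<^sup>2 / \<bar>(real (Suc d))\<^sup>2 - (real j)\<^sup>2\<bar>)"
    unfolding set by (subst prod.insert) (simp_all add: mult.commute)
  also have "\<dots> * (fact (Suc d - j) * fact (Suc d + j)) = ?P * ((real (Suc d))\<^sup>2 * (fact (d - j) * fact (d + j)))"
    unfolding factor[symmetric] by (simp only: mult.assoc)
  also have "\<dots> = (real (Suc d))\<^sup>2 * (2 * (fact d)\<^sup>2)"
    unfolding step.IH[symmetric] by (simp only: mult_ac)
  also have "\<dots> = 2 * (fact (Suc d))\<^sup>2"
    by (simp add: power_mult_distrib)
  finally show ?case .
qed

lemma prod_square_ratio_le:
  assumes "1 \<le> j" "j \<le> d"
  shows "(\<Prod>i\<in>{1..d} - {j}. (real i)\<^sup>2 / \<bar>(real i)\<^sup>2 - (real j)\<^sup>2\<bar>) \<le> 2"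
proof -
  let ?F = "fact (d - j) * fact (d + j) :: real"
  have "(\<Prod>i\<in>{1..d} - {j}. (real i)\<^sup>2 / \<bar>(real i)\<^sup>2 - (real j)\<^sup>2\<bar>) * ?F \<le> 2 * ?F"
    unfolding prod_square_ratio[OF assms] using fact_mult_le[OF assms(2)] by (simp add: power2_eq_square)
  then show ?thesis
    by (simp add: mult_le_cancel_right)
qed

text \<open>Telescoping: \<open>(2 * m + 3)^2\<close> exceeds \<open>4 * (m + 1) * (m + 2)\<close>,
  whose reciprocal is a difference of consecutive terms.\<close>

lemma sum_odd_inverse_squares:
  "(\<Sum>j = 2..d. if odd j then 1 / (2 * (real j)\<^sup>2) else 0) < 1 / 8"
proof -
  let ?s = "\<lambda>j. if odd j then 1 / (2 * (real j)\<^sup>2) else 0"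
  have odd_bound: "(\<Sum>j = 2..2 * m + 1. ?s j) \<le> 1 / 8 - 1 / (8 * (real m + 1))" for m
  proof (induction m)
    case (Suc m)
    have "{2..2 * Suc m + 1} = insert (2 * m + 3) (insert (2 * m + 2) {2..2 * m + 1})"
      by auto
    then have "(\<Sum>j = 2..2 * Suc m + 1. ?s j) = (\<Sum>j = 2..2 * m + 1. ?s j) + 1 / (2 * (2 * real m + 3)\<^sup>2)"
      by (simp add: algebra_simps)
    also have "1 / (2 * (2 * real m + 3)\<^sup>2) \<le> 1 / (8 * ((real m + 1) * (real m + 2)))"
      by (intro divide_left_mono) (auto simp: power2_eq_square algebra_simps add_pos_nonneg)
    also have "\<dots> = 1 / (8 * (real m + 1)) - 1 / (8 * (real (Suc m) + 1))"
      by (simp add: divide_simps) (simp add: algebra_simps)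
    finally show ?case
      using Suc by simp
  qed simp
  have "(\<Sum>j = 2..d. ?s j) \<le> (\<Sum>j = 2..2 * d + 1. ?s j)"
    by (intro sum_mono2) auto
  also have "\<dots> \<le> 1 / 8 - 1 / (8 * (real d + 1))"
    by (rule odd_bound)
  also have "\<dots> < 1 / 8"
    by simp
  finally show ?thesis .
qed

section \<open>Nodes and their divided-difference coefficients\<close>

text \<open>Quadratic spacing, as near an end of the Chebyshev extremal points, reduces products of
  node differences to factorials. The values are integers, so they can serve as layer sizes.\<close>

definition node :: "nat \<Rightarrow> real" where
  "node j = 2 * (real j)\<^sup>2"

text \<open>Over the points 0, 1 and the nodes up to \<open>d\<close>, the divided-difference
  coefficient at \<open>node j\<close> divided by the one at 1 is
  \<open>- ratio d j / node j\<close>.\<close>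

definition ratio :: "nat \<Rightarrow> nat \<Rightarrow> real" where
  "ratio d j = (\<Prod>i\<in>{1..d} - {j}. (node i - 1) / (node i - node j))"

lemma node_inj: "node i = node j \<longleftrightarrow> i = j"
  by (simp add: node_def)

lemma node_ge: "1 \<le> j \<Longrightarrow> 2 \<le> node j"
  by (simp add: node_def)

lemma node_less: "i < j \<Longrightarrow> node i < node j"
  unfolding node_def by (simp add: power_strict_mono)

text \<open>Exactly the \<open>j - 1\<close> factors with \<open>i < j\<close> have a negative
  denominator, an odd number for even \<open>j\<close>.\<close>

lemma ratio_even_nonpos:
  assumes "even j" "1 \<le> j" "j \<le> d"
  shows "ratio d j \<le> 0"
proof -
  have set: "{1..d} - {j} = {1..<j} \<union> {j<..d}"
    using assms by auto
  have "ratio d j = (\<Prod>i = 1..<j. (node i - 1) / (node i - node j)) *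
      (\<Prod>i\<in>{j<..d}. (node i - 1) / (node i - node j))"
    unfolding ratio_def set by (rule prod.union_disjoint) auto
  also have "(\<Prod>i = 1..<j. (node i - 1) / (node i - node j)) =
      (\<Prod>i = 1..<j. - 1 * ((node i - 1) / (node j - node i)))"
    by (intro prod.cong refl) (metis minus_diff_eq minus_divide_right mult_minus1)
  also have "\<dots> = (- 1) ^ (j - 1) * (\<Prod>i = 1..<j. (node i - 1) / (node j - node i))"
    by (subst prod.distrib) simp
  also have "(- 1) ^ (j - 1) = (- 1 :: real)"
    using assms by (simp add: minus_one_power_iff)
  finally have eq: "ratio d j = - ((\<Prod>i = 1..<j. (node i - 1) / (node j - node i)) *
      (\<Prod>i\<in>{j<..d}. (node i - 1) / (node i - node j)))"
    by simp
  have "1 \<le> node i" if "1 \<le> i" for i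
    using node_ge[OF that] by simp
  then have "0 \<le> (\<Prod>i = 1..<j. (node i - 1) / (node j - node i))"
    "0 \<le> (\<Prod>i\<in>{j<..d}. (node i - 1) / (node i - node j))"
    using assms node_less[THEN less_imp_le] by (auto intro!: prod_nonneg divide_nonneg_nonneg)
  then show ?thesis
    unfolding eq by simp
qed

text \<open>The factors are \<open>1 - 1 / node i\<close> times the ratios of squares, whose product
  is at most 2. Of the former only the one for a chosen \<open>k\<close> is kept.\<close>

lemma abs_ratio_le:
  assumes "1 \<le> j" "j \<le> d" "k \<in> {1..d} - {j}"
  shows "\<bar>ratio d j\<bar> \<le> 2 * (1 - 1 / node k)"
proof -
  let ?I = "{1..d} - {j}"
  have n2: "2 \<le> node i" if "i \<in> ?I" for i
    using that node_ge by auto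
  have "\<bar>ratio d j\<bar> = (\<Prod>i\<in>?I. (1 - 1 / node i) * ((real i)\<^sup>2 / \<bar>(real i)\<^sup>2 - (real j)\<^sup>2\<bar>))"
    unfolding ratio_def abs_prod
  proof (intro prod.cong refl)
    fix i assume i: "i \<in> ?I"
    have "node i - node j = 2 * ((real i)\<^sup>2 - (real j)\<^sup>2)"
      by (simp add: node_def)
    then have "\<bar>node i - node j\<bar> = 2 * \<bar>(real i)\<^sup>2 - (real j)\<^sup>2\<bar>"
      by (simp only: abs_mult abs_numeral)
    moreover have "1 - 1 / node i = (node i - 1) / node i"
      using n2[OF i] by (simp add: field_simps)
    ultimately show "\<bar>(node i - 1) / (node i - node j)\<bar> = (1 - 1 / node i) * ((real i)\<^sup>2 / \<bar>(real i)\<^sup>2 - (real j)\<^sup>2\<bar>)"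
      using n2[OF i] i by (simp add: abs_divide) (simp add: node_def)
  qed
  also have "\<dots> = (\<Prod>i\<in>?I. 1 - 1 / node i) * (\<Prod>i\<in>?I. (real i)\<^sup>2 / \<bar>(real i)\<^sup>2 - (real j)\<^sup>2\<bar>)"
    by (rule prod.distrib)
  also have "\<dots> \<le> (1 - 1 / node k) * 2"
  proof (rule mult_mono)
    have "(\<Prod>i\<in>?I. 1 - 1 / node i) = (1 - 1 / node k) * (\<Prod>i\<in>?I - {k}. 1 - 1 / node i)"
      by (rule prod.remove[OF _ assms(3)]) simp
    also have "\<dots> \<le> (1 - 1 / node k) * 1"
      using n2 assms(3) by (intro mult_left_mono prod_le_1) (force simp: divide_le_eq_1)+
    finally show "(\<Prod>i\<in>?I. 1 - 1 / node i) \<le> 1 - 1 / node k"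
      by simp
    show "(\<Prod>i\<in>?I. (real i)\<^sup>2 / \<bar>(real i)\<^sup>2 - (real j)\<^sup>2\<bar>) \<le> 2"
      by (rule prod_square_ratio_le[OF assms(1,2)])
    show "0 \<le> 1 - 1 / node k"
      using n2[OF assms(3)] by simp
    show "0 \<le> (\<Prod>i\<in>?I. (real i)\<^sup>2 / \<bar>(real i)\<^sup>2 - (real j)\<^sup>2\<bar>)"
      by (intro prod_nonneg) auto
  qed
  finally show ?thesis
    by simp
qed

text \<open>For \<open>j = 1\<close> the factor kept is that of \<open>k = 2\<close>, giving
  \<open>7 / 8\<close>; for larger \<open>j\<close> it is that of \<open>k = 1\<close>, which
  cancels the 2. The odd \<open>j \<ge> 3\<close> then add less than \<open>1 / 8\<close>.\<close>

lemma sum_ratio_less_1: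
  assumes "1 \<le> d"
  shows "(\<Sum>j = 1..d. if odd j then \<bar>ratio d j\<bar> / node j else 0) < 1"
proof -
  have first: "\<bar>ratio d 1\<bar> / node 1 \<le> 7 / 8"
  proof (cases "d = 1")
    case True
    then show ?thesis
      by (simp add: ratio_def node_def)
  next
    case False
    then have "\<bar>ratio d 1\<bar> \<le> 2 * (1 - 1 / node 2)"
      using assms by (intro abs_ratio_le) auto
    then show ?thesis
      by (simp add: node_def)
  qed
  have rest: "\<bar>ratio d j\<bar> / node j \<le> 1 / (2 * (real j)\<^sup>2)" if "j \<in> {2..d}" for j
  proof -
    have "\<bar>ratio d j\<bar> \<le> 2 * (1 - 1 / node 1)"
      using that by (intro abs_ratio_le) auto
    then show ?thesis
      by (simp add: node_def divide_right_mono)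
  qed
  have "{1..d} = insert 1 {2..d}"
    using assms by auto
  then have "(\<Sum>j = 1..d. if odd j then \<bar>ratio d j\<bar> / node j else 0) =
      \<bar>ratio d 1\<bar> / node 1 + (\<Sum>j = 2..d. if odd j then \<bar>ratio d j\<bar> / node j else 0)"
    by simp
  also have "\<dots> \<le> 7 / 8 + (\<Sum>j = 2..d. if odd j then 1 / (2 * (real j)\<^sup>2) else 0)"
    using first rest by (intro add_mono sum_mono) auto
  also have "\<dots> < 1"
    using sum_odd_inverse_squares[of d] by simp
  finally show ?thesis .
qed

text \<open>The divided difference of order \<open>d + 1\<close> over the nodes vanishes, whereas the coefficient at \<open>1\<close> exceeds in absolute value the sum of those of the opposite sign at the nodes \<open>2 j\<^sup>2\<close>, and the value at \<open>0\<close> is zero.\<close>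

lemma bounded_at_nodes_contradiction:
  fixes p :: "real poly"
  assumes "1 \<le> d" "degree p \<le> d" "poly p 0 = 0" "poly p 1 = 1"
    and "\<And>j. j \<in> {1..d} \<Longrightarrow> 0 \<le> poly p (node j)" "\<And>j. j \<in> {1..d} \<Longrightarrow> poly p (node j) \<le> 1"
  shows False
proof -
  let ?N = "node ` {1..d}"
  let ?X = "insert 0 (insert 1 ?N)"
  define w where "w t = (\<Prod>s\<in>?X - {t}. t - s)" for t
  have n2: "2 \<le> node i" if "i \<in> {1..d}" for i
    using that node_ge by auto
  have notin: "0 \<notin> ?N" "1 \<notin> ?N"
    using n2 by force+
  have inj: "inj_on node A" for A
    by (simp add: inj_on_def node_inj)
  have "card ?X = d + 2"
    using notin by (simp add: card_image inj)
  then have "(\<Sum>t\<in>?X. poly p t / w t) = 0"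
    unfolding w_def using assms(2) by (intro divided_difference_zero) auto
  then have eq: "1 / w 1 + (\<Sum>j = 1..d. poly p (node j) / w (node j)) = 0"
    using notin by (simp add: assms(3,4) sum.reindex inj)
  have w1: "w 1 = (\<Prod>i = 1..d. 1 - node i)"
  proof -
    have "?X - {1} = insert 0 ?N"
      using notin by auto
    then show ?thesis
      unfolding w_def using notin by (simp add: prod.reindex inj)
  qed
  have wj: "w (node j) = node j * (node j - 1) * (\<Prod>i\<in>{1..d} - {j}. node j - node i)" if j: "j \<in> {1..d}" for j
  proof -
    have "?X - {node j} = insert 0 (insert 1 (node ` ({1..d} - {j})))"
      using n2[OF j] by (auto simp: node_inj)
    moreover have "0 \<notin> node ` ({1..d} - {j})" "1 \<notin> node ` ({1..d} - {j})"
      using notin by blast+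
    ultimately show ?thesis
      unfolding w_def by (simp add: prod.reindex inj)
  qed
  have w1_nz: "w 1 \<noteq> 0"
    unfolding w1 using n2 by force
  have quotient: "w 1 / w (node j) = - ratio d j / node j" if j: "j \<in> {1..d}" for j
  proof -
    have "w 1 = (1 - node j) * (\<Prod>i\<in>{1..d} - {j}. 1 - node i)"
      unfolding w1 by (rule prod.remove) (use j in auto)
    then have "w 1 / w (node j) = (1 - node j) / (node j * (node j - 1)) *
        (\<Prod>i\<in>{1..d} - {j}. (1 - node i) / (node j - node i))"
      unfolding wj[OF j] by (simp add: prod_dividef)
    also have "(1 - node j) / (node j * (node j - 1)) = - 1 / node j"
      using n2[OF j] by (simp add: field_simps)
    also have "(\<Prod>i\<in>{1..d} - {j}. (1 - node i) / (node j - node i)) = ratio d j"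
      unfolding ratio_def by (intro prod.cong refl) (metis minus_diff_eq minus_divide_divide)
    finally show ?thesis
      by simp
  qed
  \<comment> \<open>Multiplying by \<open>w 1\<close> normalises the coefficient at 1.\<close>
  have "w 1 * (1 / w 1 + (\<Sum>j = 1..d. poly p (node j) / w (node j))) = 0"
    unfolding eq by simp
  then have "1 + (\<Sum>j = 1..d. poly p (node j) * (w 1 / w (node j))) = 0"
    using w1_nz by (simp add: distrib_left sum_distrib_left mult_ac)
  moreover have "(\<Sum>j = 1..d. poly p (node j) * (w 1 / w (node j))) = (\<Sum>j = 1..d. - (poly p (node j) * (ratio d j / node j)))"
    by (intro sum.cong refl) (simp add: quotient)
  ultimately have "1 = (\<Sum>j = 1..d. poly p (node j) * (ratio d j / node j))"
    by (simp add: sum_negf)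
  also have "\<dots> \<le> (\<Sum>j = 1..d. if odd j then \<bar>ratio d j\<bar> / node j else 0)"
  proof (intro sum_mono)
    fix j assume j: "j \<in> {1..d}"
    show "poly p (node j) * (ratio d j / node j) \<le> (if odd j then \<bar>ratio d j\<bar> / node j else 0)"
    proof (cases "odd j")
      case True
      have "poly p (node j) * (ratio d j / node j) \<le> poly p (node j) * (\<bar>ratio d j\<bar> / node j)"
        using assms(5)[OF j] n2[OF j] by (intro mult_left_mono divide_right_mono) auto
      also have "\<dots> \<le> 1 * (\<bar>ratio d j\<bar> / node j)"
        using assms(6)[OF j] n2[OF j] by (intro mult_right_mono) auto
      finally show ?thesis
        using True by simp
    next
      case False
      then have "ratio d j / node j \<le> 0"
        using ratio_even_nonpos[of j d] j n2[OF j] by (auto simp: divide_nonpos_nonneg)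
      then show ?thesis
        using mult_nonneg_nonpos[OF assms(5)[OF j], of "ratio d j / node j"] False by simp
    qed
  qed
  also have "\<dots> < 1"
    by (rule sum_ratio_less_1[OF assms(1)])
  finally show False
    by simp
qed

section \<open>Hitting sets and the final bound\<close>

definition layer_avg :: "'b set \<Rightarrow> nat \<Rightarrow> ('b set \<Rightarrow> real) \<Rightarrow> real" where
  "layer_avg U t h = (\<Sum>T | T \<subseteq> U \<and> card T = t. h T) / real (card U choose t)"

lemma layer_avg_add: "layer_avg U t (\<lambda>T. h T + h' T) = layer_avg U t h + layer_avg U t h'"
  by (simp add: layer_avg_def sum.distrib add_divide_distrib)

lemma layer_avg_sum: "layer_avg U t (\<lambda>T. \<Sum>i\<in>I. h i T) = (\<Sum>i\<in>I. layer_avg U t (h i))"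
  unfolding layer_avg_def by (subst sum.swap) (simp add: sum_divide_distrib)

lemma layer_avg_cmult: "layer_avg U t (\<lambda>T. r * h T) = r * layer_avg U t h"
  by (simp add: layer_avg_def sum_distrib_left)

lemma layer_avg_cong: "(\<And>T. T \<subseteq> U \<Longrightarrow> card T = t \<Longrightarrow> h T = h' T) \<Longrightarrow> layer_avg U t h = layer_avg U t h'"
  unfolding layer_avg_def by (auto intro!: arg_cong2[where f = "(/)"] sum.cong)

lemma layer_avg_const:
  assumes "finite U" "t \<le> card U"
  shows "layer_avg U t (\<lambda>_. r) = r"
  using assms n_subsets[OF assms(1), of t] by (simp add: layer_avg_def)

lemma layer_avg_mono:
  assumes "\<And>T. T \<subseteq> U \<Longrightarrow> card T = t \<Longrightarrow> h T \<le> h' T"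
  shows "layer_avg U t h \<le> layer_avg U t h'"
  unfolding layer_avg_def using assms by (intro divide_right_mono sum_mono) auto

lemma card_layer_supersets:
  assumes "finite U" "C \<subseteq> U" "card C \<le> t"
  shows "card {T. T \<subseteq> U \<and> card T = t \<and> C \<subseteq> T} = (card U - card C) choose (t - card C)"
proof -
  have fin: "finite C"
    using assms finite_subset by blast
  have "bij_betw (\<lambda>T. T - C) {T. T \<subseteq> U \<and> card T = t \<and> C \<subseteq> T} {T. T \<subseteq> U - C \<and> card T = t - card C}"
  proof (rule bij_betw_byWitness[where f' = "\<lambda>T. T \<union> C"])
    show "(\<lambda>T. T - C) ` {T. T \<subseteq> U \<and> card T = t \<and> C \<subseteq> T} \<subseteq> {T. T \<subseteq> U - C \<and> card T = t - card C}"
      using fin by (auto simp: card_Diff_subset)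
    show "(\<lambda>T. T \<union> C) ` {T. T \<subseteq> U - C \<and> card T = t - card C} \<subseteq> {T. T \<subseteq> U \<and> card T = t \<and> C \<subseteq> T}"
    proof (rule image_subsetI)
      fix T assume "T \<in> {T. T \<subseteq> U - C \<and> card T = t - card C}"
      then have T: "T \<subseteq> U - C" "card T = t - card C"
        by auto
      then have "finite T" "T \<inter> C = {}"
        using assms(1) finite_subset by auto
      with T fin show "T \<union> C \<in> {T. T \<subseteq> U \<and> card T = t \<and> C \<subseteq> T}"
        using assms(2,3) by (auto simp: card_Un_disjoint)
    qed
  qed auto
  then have "card {T. T \<subseteq> U \<and> card T = t \<and> C \<subseteq> T} = card {T. T \<subseteq> U - C \<and> card T = t - card C}"
    by (rule bij_betw_same_card)
  also have "\<dots> = (card U - card C) choose (t - card C)"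
    using assms fin by (simp add: n_subsets card_Diff_subset)
  finally show ?thesis .
qed

text \<open>The probability that a uniform \<open>t\<close>-subset contains \<open>C\<close>. The
  denominator is independent of \<open>t\<close>, so this is polynomial in \<open>t\<close>.\<close>

lemma layer_avg_monomial:
  assumes "finite U" "C \<subseteq> U" "t \<le> card U"
  shows "layer_avg U t (\<lambda>T. if C \<subseteq> T then 1 else 0) = real (t choose card C) / real (card U choose card C)"
proof -
  have C: "card C \<le> card U"
    using assms by (simp add: card_mono)
  have fin: "finite {T. T \<subseteq> U \<and> P T}" for P
    using assms(1) by (rule_tac finite_subset[of _ "Pow U"]) auto
  let ?N = "card {T. T \<subseteq> U \<and> card T = t \<and> C \<subseteq> T}"
  have "(\<Sum>T | T \<subseteq> U \<and> card T = t. if C \<subseteq> T then 1 else 0 :: real) = real ?N"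
  proof -
    have "{T. T \<subseteq> U \<and> card T = t} \<inter> {T. C \<subseteq> T} = {T. T \<subseteq> U \<and> card T = t \<and> C \<subseteq> T}"
      by auto
    then show ?thesis
      using fin by (simp add: sum.If_cases)
  qed
  then have avg: "layer_avg U t (\<lambda>T. if C \<subseteq> T then 1 else 0) = real ?N / real (card U choose t)"
    by (simp add: layer_avg_def)
  have "?N * (card U choose card C) = (card U choose t) * (t choose card C)"
  proof (cases "card C \<le> t")
    case True
    then show ?thesis
      using choose_mult[OF True assms(3)] card_layer_supersets[OF assms(1,2) True] by (simp add: mult.commute)
  next
    case False
    have "{T. T \<subseteq> U \<and> card T = t \<and> C \<subseteq> T} = {}"
      using False assms(1) by (auto dest: finite_subset card_mono)
    then have "?N = 0"
      by (simp only: card.empty)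
    then show ?thesis
      using False by (simp add: binomial_eq_0)
  qed
  then have "real ?N * real (card U choose card C) = real (card U choose t) * real (t choose card C)"
    unfolding of_nat_mult[symmetric] by (rule arg_cong)
  moreover have "real (card U choose card C) \<noteq> 0" "real (card U choose t) \<noteq> 0"
    using assms(3) C by simp_all
  ultimately show ?thesis
    unfolding avg by (simp add: frac_eq_eq mult.commute)
qed

lemma binomial_poly: "\<exists>p. degree p \<le> c \<and> (\<forall>t. real (t choose c) = poly p (real t))"
proof (intro exI conjI allI)
  let ?p = "smult (1 / fact c) (\<Prod>i = 0..<c. [:- real i, 1:])"
  have "degree (\<Prod>i = 0..<c. [:- real i, 1:]) \<le> c"
    by (rule order.trans[OF degree_prod_sum_le]) simp_all
  then show "degree ?p \<le> c"
    by (rule order.trans[OF degree_smult_le])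
  show "real (t choose c) = poly ?p (real t)" for t
    by (simp add: binomial_gbinomial gbinomial_prod_rev poly_prod)
qed

text \<open>Symmetrisation in the manner of Minsky and Papert. The set \<open>C\<close> is there for
  the induction: it collects the elements of \<open>A\<close> already split off as a
  monomial.\<close>

lemma layer_avg_junta_poly:
  assumes "finite A" "finite U" "A \<subseteq> U" "C \<subseteq> U" "\<And>T. T \<subseteq> U \<Longrightarrow> h T = h (T \<inter> A)"
  shows "\<exists>p. degree p \<le> card A + card C \<and>
    (\<forall>t\<le>card U. layer_avg U t (\<lambda>T. if C \<subseteq> T then h T else 0) = poly p (real t))"
  using assms
proof (induction A arbitrary: h C)
  case empty
  obtain p where p: "degree p \<le> card C" "\<And>t. real (t choose card C) = poly p (real t)"
    using binomial_poly by blast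
  have "layer_avg U t (\<lambda>T. if C \<subseteq> T then h T else 0) = poly (smult (h {} / real (card U choose card C)) p) (real t)"
    if "t \<le> card U" for t
  proof -
    have "layer_avg U t (\<lambda>T. if C \<subseteq> T then h T else 0) = layer_avg U t (\<lambda>T. h {} * (if C \<subseteq> T then 1 else 0))"
    proof (rule layer_avg_cong)
      fix T assume "T \<subseteq> U"
      then have "h T = h {}"
        using empty.prems(4)[of T] by simp
      then show "(if C \<subseteq> T then h T else 0) = h {} * (if C \<subseteq> T then 1 else 0)"
        by simp
    qed
    then show ?thesis
      using layer_avg_monomial[OF empty.prems(1,3) that] by (simp add: layer_avg_cmult p(2))
  qed
  moreover have "degree (smult (h {} / real (card U choose card C)) p) \<le> card {} + card C"
    using p(1) by (simp add: order.trans[OF degree_smult_le])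
  ultimately show ?case
    by blast
next
  case (insert a A)
  \<comment> \<open>\<open>h\<close> is \<open>h0\<close>, plus \<open>h1\<close> on the sets
    containing \<open>a\<close>; neither part depends on \<open>a\<close>.\<close>
  define h0 where "h0 T = h (T - {a})" for T
  define h1 where "h1 T = h (insert a T) - h (T - {a})" for T
  have dep: "h T = h (T \<inter> insert a A)" if "T \<subseteq> U" for T
    using insert.prems(4) that by blast
  have U: "A \<subseteq> U" "a \<in> U" "insert a C \<subseteq> U"
    using insert.prems by auto
  have rest: "h (T - {a}) = h (T \<inter> A - {a})" if "T \<subseteq> U" for T
  proof -
    have "h (T - {a}) = h ((T - {a}) \<inter> insert a A)"
      using that by (intro dep) auto
    also have "(T - {a}) \<inter> insert a A = T \<inter> A - {a}"
      by auto
    finally show ?thesis .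
  qed
  have "h (insert a T) = h (insert a (T \<inter> A))" if "T \<subseteq> U" for T
  proof -
    have "insert a T \<inter> insert a A = insert a (T \<inter> A)"
      by auto
    then show ?thesis
      using that U dep[of "insert a T"] by simp
  qed
  with rest have "h1 T = h1 (T \<inter> A)" if "T \<subseteq> U" for T
    unfolding h1_def using that by (metis)
  then obtain p1 where p1: "degree p1 \<le> card A + card (insert a C)"
    "\<And>t. t \<le> card U \<Longrightarrow> layer_avg U t (\<lambda>T. if insert a C \<subseteq> T then h1 T else 0) = poly p1 (real t)"
    using insert.IH[of "insert a C" h1] insert.prems(1) U by blast
  have "h0 T = h0 (T \<inter> A)" if "T \<subseteq> U" for T
    unfolding h0_def using rest that by metis
  then obtain p0 where p0: "degree p0 \<le> card A + card C"
    "\<And>t. t \<le> card U \<Longrightarrow> layer_avg U t (\<lambda>T. if C \<subseteq> T then h0 T else 0) = poly p0 (real t)"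
    using insert.IH[of C h0] insert.prems(1,3) U by blast
  have "finite C"
    using insert.prems(1,3) finite_subset by blast
  then have "degree (p0 + p1) \<le> card (insert a A) + card C"
    using insert.hyps p0(1) p1(1) by (intro degree_add_le) (auto simp: card_insert_if split: if_splits)
  moreover have "layer_avg U t (\<lambda>T. if C \<subseteq> T then h T else 0) = poly (p0 + p1) (real t)" if "t \<le> card U" for t
  proof -
    have "(if C \<subseteq> T then h T else 0) = (if C \<subseteq> T then h0 T else 0) + (if insert a C \<subseteq> T then h1 T else 0)" for T
      by (auto simp: h0_def h1_def insert_absorb)
    then show ?thesis
      by (simp only: layer_avg_add p0(2) p1(2) that poly_add)
  qed
  ultimately show ?case
    by blast
qed

lemma layer_avg_0:
  assumes "finite U"
  shows "layer_avg U 0 h = h {}"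
proof -
  have "{T. T \<subseteq> U \<and> card T = 0} = {{}}"
    using assms finite_subset by fastforce
  then show ?thesis
    by (simp add: layer_avg_def)
qed

section \<open>Disjoint sensitive blocks\<close>

text \<open>Replacing \<open>x\<close> by \<open>y B\<close> on the blocks of a random
  \<open>t\<close>-subset gives an expected value of \<open>f\<close> that is a polynomial in
  \<open>t\<close> of degree at most \<open>d\<close>. It lies in \<open>[0, 1]\<close> on all
  layers but moves from \<open>f x\<close> at 0 to \<open>1 - f x\<close> at 1; the nodes up to
  \<open>2 d^2\<close> exclude this.\<close>

lemma sensitive_blocks_bound:
  fixes f :: "(nat \<Rightarrow> 'a) \<Rightarrow> real"
  assumes "f \<in> low n d" "1 \<le> d" "boolean f" "finite \<D>" "disjoint \<D>"
    and y: "\<And>B i. B \<in> \<D> \<Longrightarrow> i \<notin> B \<Longrightarrow> y B i = x i" "\<And>B. B \<in> \<D> \<Longrightarrow> f (y B) \<noteq> f x"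
  shows "card \<D> < 2 * d\<^sup>2"
proof (rule ccontr)
  assume "\<not> ?thesis"
  then have m: "2 * d\<^sup>2 \<le> card \<D>"
    by simp
  define z where "z T i = (if \<exists>B\<in>T. i \<in> B then y (THE B. B \<in> \<D> \<and> i \<in> B) i else x i)" for T i
  have the_B: "(THE B. B \<in> \<D> \<and> i \<in> B) = B" if "B \<in> \<D>" "i \<in> B" for B i
    using that assms(5) by (intro the_equality) (auto simp: disjoint_def)
  have z_empty: "z {} = x"
    by (auto simp: z_def)
  have z_single: "z {B} = y B" if "B \<in> \<D>" for B
    using that the_B y(1) by (auto simp: z_def)
  let ?\<F> = "{S. S \<subseteq> {..<n} \<and> card S \<le> d}"
  obtain c where c: "\<forall>S\<in>?\<F>. depends_on S (c S)" "f = (\<lambda>x. \<Sum>S\<in>?\<F>. c S x)"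
    using assms(1) unfolding low_def spanned_def by auto
  have "\<forall>S\<in>?\<F>. \<exists>p. degree p \<le> d \<and> (\<forall>t\<le>card \<D>. layer_avg \<D> t (\<lambda>T. c S (z T)) = poly p (real t))"
  proof
    fix S assume S: "S \<in> ?\<F>"
    let ?A = "{B \<in> \<D>. B \<inter> S \<noteq> {}}"
    have "finite S"
      using S finite_subset by auto
    have "c S (z T) = c S (z (T \<inter> ?A))" if "T \<subseteq> \<D>" for T
    proof (rule depends_onD[of S "c S"])
      show "depends_on S (c S)"
        using c(1) S by blast
      fix i assume "i \<in> S"
      then have "(\<exists>B\<in>T. i \<in> B) = (\<exists>B\<in>T \<inter> ?A. i \<in> B)"
        using that by auto
      then show "z T i = z (T \<inter> ?A) i"
        by (simp only: z_def)
    qed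
    then obtain p where p: "degree p \<le> card ?A + card ({} :: nat set set)"
      "\<forall>t\<le>card \<D>. layer_avg \<D> t (\<lambda>T. if {} \<subseteq> T then c S (z T) else 0) = poly p (real t)"
      using layer_avg_junta_poly[of ?A \<D> "{}" "\<lambda>T. c S (z T)"] assms(4) by auto
    \<comment> \<open>Choosing a point of \<open>S\<close> in each block that meets \<open>S\<close>
      is injective, as the blocks are disjoint.\<close>
    have "card ?A \<le> card S"
    proof (rule card_inj_on_le[where f = "\<lambda>B. SOME i. i \<in> B \<inter> S"])
      have some: "(SOME i. i \<in> B \<inter> S) \<in> B \<inter> S" if "B \<in> ?A" for B
        using that by (intro someI_ex[of "\<lambda>i. i \<in> B \<inter> S"]) auto
      then show "(\<lambda>B. SOME i. i \<in> B \<inter> S) ` ?A \<subseteq> S"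
        by blast
      show "inj_on (\<lambda>B. SOME i. i \<in> B \<inter> S) ?A"
      proof (rule inj_onI)
        fix B B' assume B: "B \<in> ?A" "B' \<in> ?A" "(SOME i. i \<in> B \<inter> S) = (SOME i. i \<in> B' \<inter> S)"
        then have "(SOME i. i \<in> B \<inter> S) \<in> B" "(SOME i. i \<in> B \<inter> S) \<in> B'"
          using some[OF B(1)] some[OF B(2)] by auto
        with B assms(5) show "B = B'"
          unfolding disjoint_def by blast
      qed
    qed fact
    then have "degree p \<le> d"
      using p(1) S by simp
    with p(2) show "\<exists>p. degree p \<le> d \<and> (\<forall>t\<le>card \<D>. layer_avg \<D> t (\<lambda>T. c S (z T)) = poly p (real t))"
      by auto
  qed
  from bchoice[OF this] obtain P where "\<forall>S\<in>?\<F>. degree (P S) \<le> d \<and>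
      (\<forall>t\<le>card \<D>. layer_avg \<D> t (\<lambda>T. c S (z T)) = poly (P S) (real t))"
    by (rule exE)
  then have P: "\<And>S. S \<in> ?\<F> \<Longrightarrow> degree (P S) \<le> d"
    "\<And>S t. S \<in> ?\<F> \<Longrightarrow> t \<le> card \<D> \<Longrightarrow> layer_avg \<D> t (\<lambda>T. c S (z T)) = poly (P S) (real t)"
    by simp_all
  define p where "p = (\<Sum>S\<in>?\<F>. P S)"
  have deg: "degree p \<le> d"
    unfolding p_def using P(1) by (intro degree_sum_le) auto
  have poly_p: "poly p (real t) = layer_avg \<D> t (\<lambda>T. f (z T))" if "t \<le> card \<D>" for t
    unfolding p_def poly_sum c(2) layer_avg_sum using that P(2) by (intro sum.cong) auto
  have f01: "f w = 0 \<or> f w = 1" for w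
    using assms(3) by (auto simp: boolean_def)
  have p0: "poly p 0 = f x"
    using poly_p[of 0] assms(4) by (simp add: layer_avg_0 z_empty)
  have p1: "poly p 1 = 1 - f x"
  proof -
    have "1 \<le> card \<D>"
    proof -
      have "1 \<le> d\<^sup>2"
        using assms(2) by simp
      with m show ?thesis
        by linarith
    qed
    then have "poly p 1 = layer_avg \<D> 1 (\<lambda>T. f (z T))"
      using poly_p[of 1] by simp
    also have "\<dots> = layer_avg \<D> 1 (\<lambda>_. 1 - f x)"
    proof (rule layer_avg_cong)
      fix T assume "T \<subseteq> \<D>" "card T = 1"
      then obtain B where "T = {B}" "B \<in> \<D>"
        by (metis card_1_singletonE insert_subset)
      then show "f (z T) = 1 - f x"
        using z_single[of B] y(2)[of B] f01[of x] f01[of "y B"] by auto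
    qed
    also have "\<dots> = 1 - f x"
      using assms(4) \<open>1 \<le> card \<D>\<close> by (rule layer_avg_const)
    finally show ?thesis .
  qed
  have bounds: "0 \<le> poly p (node j)" "poly p (node j) \<le> 1" if "j \<in> {1..d}" for j
  proof -
    have "j\<^sup>2 \<le> d\<^sup>2"
      using that by (intro power_mono) auto
    then have t: "2 * j\<^sup>2 \<le> card \<D>"
      using m by linarith
    have "node j = real (2 * j\<^sup>2)"
      by (simp add: node_def)
    then have eq: "poly p (node j) = layer_avg \<D> (2 * j\<^sup>2) (\<lambda>T. f (z T))"
      using poly_p[OF t] by simp
    have le: "0 \<le> f w" "f w \<le> 1" for w
      using f01[of w] by auto
    show "0 \<le> poly p (node j)"
      unfolding eq using layer_avg_mono[of \<D> "2 * j\<^sup>2" "\<lambda>_. 0" "\<lambda>T. f (z T)"] le layer_avg_const[OF assms(4) t, of 0] by simp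
    show "poly p (node j) \<le> 1"
      unfolding eq using layer_avg_mono[of \<D> "2 * j\<^sup>2" "\<lambda>T. f (z T)" "\<lambda>_. 1"] le layer_avg_const[OF assms(4) t, of 1] by simp
  qed
  from f01[of x] show False
  proof
    assume "f x = 0"
    with bounded_at_nodes_contradiction[OF assms(2) deg] p0 p1 bounds show False
      by simp
  next
    assume "f x = 1"
    \<comment> \<open>Passing to \<open>1 - p\<close> reduces this case to value 0 at
      \<open>x\<close>.\<close>
    have "degree (1 - p) \<le> d"
      using deg by (intro degree_diff_le) auto
    from bounded_at_nodes_contradiction[OF assms(2) this] show False
      using p0 p1 bounds \<open>f x = 1\<close> by simp
  qed
qed

section \<open>Degree reduction and the bound on the number of relevant variables\<close>

lemma weight_step:
  fixes f :: "(nat \<Rightarrow> 'a::finite) \<Rightarrow> real"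
  assumes "f \<in> low n d" "1 \<le> d" "boolean f"
  shows "\<exists>g \<in> low n (d - 1). boolean (g :: (nat \<Rightarrow> 'a) \<Rightarrow> real) \<and>
    weight_sum n {..<n} f \<le> 2 * real d ^ 3 / real CARD('a) ^ (d - 1) + weight_sum n {..<n} g"
proof -
  let ?q = "real CARD('a)"
  obtain \<T> where T: "top_family n d f \<T>"
    using ex_top_family[OF assms(1)] by blast
  have T_sub: "S \<subseteq> {..<n}" "card S = d" if "S \<in> \<T>" for S
    using T that unfolding top_family_def by auto
  have "{} \<notin> \<T>"
    using T_sub(2)[of "{}"] assms(2) by auto
  then obtain \<D> where D: "\<D> \<subseteq> \<T>" "disjoint \<D>" "\<And>S. S \<in> \<T> \<Longrightarrow> S \<inter> \<Union>\<D> \<noteq> {}"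
    using maximal_disjoint_subfamily[OF top_family_finite[OF T]] by blast
  have "finite \<D>"
    using D(1) top_family_finite[OF T] finite_subset by blast
  define H where "H = \<Union>\<D>"
  have H: "H \<subseteq> {..<n}"
    unfolding H_def using D(1) T_sub(1) by blast
  then have "finite H"
    using finite_subset by blast
  \<comment> \<open>Any base point will do, as sensitivity to the sets in \<open>\<D>\<close> holds
    everywhere.\<close>
  fix x :: "nat \<Rightarrow> 'a"
  have "\<exists>y. (\<forall>i. i \<notin> B \<longrightarrow> y i = x i) \<and> f y \<noteq> f x" if "B \<in> \<D>" for B
    using top_family_nonconst[OF T _ assms(2)] that D(1) by blast
  then obtain y where "\<And>B. B \<in> \<D> \<Longrightarrow> (\<forall>i. i \<notin> B \<longrightarrow> y B i = x i) \<and> f (y B) \<noteq> f x"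
    by metis
  then have "card \<D> < 2 * d\<^sup>2"
    using sensitive_blocks_bound[OF assms \<open>finite \<D>\<close> D(2), of y x] by blast
  have "card H \<le> (\<Sum>B\<in>\<D>. card B)"
    unfolding H_def by (rule card_Union_le_sum_card)
  also have "\<dots> = card \<D> * d"
    using D(1) T_sub(2) by (simp add: subset_iff)
  also have "\<dots> \<le> 2 * d\<^sup>2 * d"
    using \<open>card \<D> < 2 * d\<^sup>2\<close> by (intro mult_right_mono) auto
  finally have card_H: "card H \<le> 2 * d ^ 3"
    by (simp add: power2_eq_square power3_eq_cube mult.assoc)
  have H_weight: "local_weight n f i \<le> 1 / ?q ^ (d - 1)" if i: "i \<in> H" for i
  proof -
    obtain S where "S \<in> \<T>" "i \<in> S"
      using i D(1) unfolding H_def by blast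
    then have "d - 1 \<le> local_degree n i f"
      using top_family_local_degree[OF T _ _ assms(1)] by blast
    then have "1 / ?q ^ local_degree n i f \<le> 1 / ?q ^ (d - 1)"
      by (intro divide_left_mono power_increasing) (auto simp: Suc_le_eq)
    then show ?thesis
      by (simp add: local_weight_def)
  qed
  \<comment> \<open>Only the variables outside \<open>H\<close> have to keep their total weight;
    those in \<open>H\<close> are paid for by \<open>H_weight\<close>.\<close>
  obtain \<alpha> where \<alpha>: "weight_sum n ({..<n} - H) f \<le> weight_sum n ({..<n} - H) (override H \<alpha> f)"
    using weight_sum_override[OF assms(1), of "{..<n} - H" H] \<open>finite H\<close> by auto
  let ?g = "override H \<alpha> f"
  have "weight_sum n {..<n} f = (\<Sum>i\<in>H. local_weight n f i) + weight_sum n ({..<n} - H) f"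
    using H by (simp add: weight_sum_eq sum.subset_diff add.commute)
  also have "(\<Sum>i\<in>H. local_weight n f i) \<le> real (card H) * (1 / ?q ^ (d - 1))"
    using H_weight by (rule sum_bounded_above)
  also have "\<dots> \<le> 2 * real d ^ 3 * (1 / ?q ^ (d - 1))"
  proof (rule mult_right_mono)
    show "real (card H) \<le> 2 * real d ^ 3"
      using card_H by (metis of_nat_le_iff of_nat_mult of_nat_numeral of_nat_power)
  qed simp
  also have "weight_sum n ({..<n} - H) f \<le> weight_sum n ({..<n} - H) ?g"
    by (rule \<alpha>)
  also have "\<dots> \<le> weight_sum n {..<n} ?g"
    by (simp add: weight_sum_eq) (intro sum_mono2, auto simp: local_weight_nonneg)
  finally have "weight_sum n {..<n} f \<le> 2 * real d ^ 3 / ?q ^ (d - 1) + weight_sum n {..<n} ?g"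
    by simp
  moreover have "?g \<in> low n (d - 1)"
    using low_override_hitting[OF T _ assms(2)] D(3) unfolding H_def by blast
  moreover have "boolean ?g"
    using assms(3) by (simp add: boolean_def override_def)
  ultimately show ?thesis
    by blast
qed

text \<open>The influence bound starts the induction at degree \<open>m\<close>, and
  \<open>weight_step\<close> adds one term per degree; dividing by \<open>q\<close> raises the
  exponent from \<open>d - 1\<close> to \<open>d\<close>.\<close>

lemma weight_sum_bound:
  fixes f :: "(nat \<Rightarrow> 'a::finite) \<Rightarrow> real"
  assumes "m \<le> d" "f \<in> low n d" "boolean f" "2 \<le> CARD('a)"
  shows "weight_sum n {..<n} f / CARD('a) \<le>
    real m * real CARD('a) / (4 * (real CARD('a) - 1)) + (\<Sum>e\<in>{m<..d}. 2 * real e ^ 3 / real CARD('a) ^ e)"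
  using assms(1-3)
proof (induction d arbitrary: f rule: dec_induct)
  case base
  then show ?case
    using weight_sum_le_influence[OF base(1,2) assms(4)] by simp
next
  case (step d)
  let ?q = "real CARD('a)"
  have "1 \<le> Suc d"
    by simp
  from weight_step[OF step.prems(1) this step.prems(2)]
  obtain g :: "(nat \<Rightarrow> 'a) \<Rightarrow> real" where "g \<in> low n (Suc d - 1)"
    "boolean g \<and> weight_sum n {..<n} f \<le> 2 * real (Suc d) ^ 3 / ?q ^ (Suc d - 1) + weight_sum n {..<n} g"
    by (rule bexE)
  then have g: "g \<in> low n d" "boolean g"
    "weight_sum n {..<n} f \<le> 2 * real (Suc d) ^ 3 / ?q ^ d + weight_sum n {..<n} g"
    by simp_all
  have set: "{m<..Suc d} = insert (Suc d) {m<..d}"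
    using step.hyps by auto
  have "weight_sum n {..<n} f / ?q \<le> (2 * real (Suc d) ^ 3 / ?q ^ d + weight_sum n {..<n} g) / ?q"
    using g(3) by (intro divide_right_mono) auto
  also have "\<dots> = 2 * real (Suc d) ^ 3 / ?q ^ Suc d + weight_sum n {..<n} g / ?q"
    by (simp add: add_divide_distrib mult.commute)
  finally show ?case
    unfolding set using step.IH[OF g(1,2)] by simp
qed

text \<open>Local degrees are at most \<open>d - 1\<close>, so each relevant variable has weight at
  least \<open>1 / q^(d - 1)\<close>.\<close>

lemma card_relevant_le_weight_sum:
  fixes f :: "(nat \<Rightarrow> 'a::finite) \<Rightarrow> real"
  assumes "f \<in> low n d" "1 \<le> d"
  shows "card {i\<in>{..<n}. relevant i f} \<le> real CARD('a) ^ d * (weight_sum n {..<n} f / CARD('a))"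
proof -
  let ?q = "real CARD('a)"
  have "real (card {i\<in>{..<n}. relevant i f}) * (1 / ?q ^ (d - 1)) \<le> weight_sum n {..<n} f"
    unfolding weight_sum_def using local_degree_le_low[OF assms(1)]
    by (intro sum_bounded_below divide_left_mono power_increasing) (auto simp: Suc_le_eq)
  moreover have "?q ^ d = ?q * ?q ^ (d - 1)"
    using assms(2) by (metis power_eq_if not_one_le_zero)
  ultimately show ?thesis
    by (simp add: field_simps)
qed

text \<open>The cubic \<open>P\<close> solves \<open>q * P k = 2 * (k + 1)^3 + P (k + 1)\<close>, so
  the sum telescopes; the four equations compare coefficients.\<close>

lemma sum_cubes_over_powers_le:
  fixes q a b c e :: real
  assumes "1 < q" "(q - 1) * a = 2" "(q - 1) * b = 6 + 3 * a" "(q - 1) * c = 6 + 3 * a + 2 * b"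
    "(q - 1) * e = 2 + a + b + c" "m \<le> d"
  shows "(\<Sum>k\<in>{m<..d}. 2 * real k ^ 3 / q ^ k) \<le> (a * real m ^ 3 + b * real m ^ 2 + c * real m + e) / q ^ m"
proof -
  define P where "P k = a * real k ^ 3 + b * real k ^ 2 + c * real k + e" for k
  have pos: "0 < a" "0 < b" "0 < c" "0 < e"
  proof -
    have *: "0 < s" if "(q - 1) * s = r" "0 < r" for s r
      using that assms(1) by (metis diff_gt_0_iff_gt zero_less_mult_pos)
    show "0 < a"
      by (rule *[OF assms(2)]) simp
    then show "0 < b"
      by (intro *[OF assms(3)]) simp
    with \<open>0 < a\<close> show "0 < c"
      by (intro *[OF assms(4)]) simp
    with \<open>0 < a\<close> \<open>0 < b\<close> show "0 < e"
      by (intro *[OF assms(5)]) simp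
  qed
  have step: "q * P k = 2 * real (Suc k) ^ 3 + P (Suc k)" for k
  proof -
    have "q * P k = ((q - 1) * a) * real k ^ 3 + ((q - 1) * b) * real k ^ 2 + ((q - 1) * c) * real k +
        (q - 1) * e + P k"
      by (simp add: P_def algebra_simps)
    then show ?thesis
      unfolding assms(2-5) P_def by (simp add: algebra_simps power2_eq_square power3_eq_cube)
  qed
  have "(\<Sum>k\<in>{m<..d}. 2 * real k ^ 3 / q ^ k) = P m / q ^ m - P d / q ^ d"
    using assms(6)
  proof (induction d rule: dec_induct)
    case (step d)
    have "{m<..Suc d} = insert (Suc d) {m<..d}"
      using step.hyps by auto
    moreover have "P d / q ^ d = q * P d / q ^ Suc d"
      using assms(1) by simp
    ultimately show ?case
      using step.IH \<open>\<And>k. q * P k = 2 * real (Suc k) ^ 3 + P (Suc k)\<close>[of d]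
      by (simp add: add_divide_distrib)
  qed simp
  moreover have "0 \<le> P d / q ^ d"
    using pos assms(1) by (simp add: P_def)
  ultimately show ?thesis
    unfolding P_def by simp
qed

lemma card_relevant_le:
  fixes f :: "(nat \<Rightarrow> 'a::finite) \<Rightarrow> real"
  assumes "f \<in> low n d" "1 \<le> d" "boolean f" "2 \<le> CARD('a)"
    and "\<And>D. m \<le> D \<Longrightarrow> real m * real CARD('a) / (4 * (real CARD('a) - 1)) +
      (\<Sum>e\<in>{m<..D}. 2 * real e ^ 3 / real CARD('a) ^ e) \<le> C"
  shows "card {i\<in>{..<n}. relevant i f} \<le> C * real CARD('a) ^ d"
proof -
  let ?q = "real CARD('a)"
  have "weight_sum n {..<n} f / ?q \<le> C"
  proof (cases "m \<le> d")
    case True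
    then show ?thesis
      using weight_sum_bound[OF True assms(1,3,4)] assms(5)[OF True] by linarith
  next
    case False
    \<comment> \<open>Below the cutoff the influence bound suffices, being increasing in the degree;
      the assumption at \<open>D = m\<close> compares its value at \<open>m\<close> with
      \<open>C\<close>.\<close>
    have "weight_sum n {..<n} f / ?q \<le> real d * ?q / (4 * (?q - 1))"
      by (rule weight_sum_le_influence[OF assms(1,3,4)])
    also have "\<dots> \<le> real m * ?q / (4 * (?q - 1))"
      using False assms(4) by (intro divide_right_mono mult_right_mono) auto
    also have "\<dots> \<le> C"
      using assms(5)[of m] by simp
    finally show ?thesis .
  qed
  then have "?q ^ d * (weight_sum n {..<n} f / ?q) \<le> ?q ^ d * C"
    by (intro mult_left_mono) auto
  then show ?thesis
    using card_relevant_le_weight_sum[OF assms(1,2)] by (simp add: mult.commute)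
qed

section \<open>Transfer from the cube to functions on a finite type\<close>

text \<open>Numbering \<open>'a\<close> by \<open>{..<q}\<close> pulls \<open>f\<close> back to
  \<open>F\<close>. A monomial is a junta on the coordinates with nonzero exponent, so coefficient
  degree bounds junta degree.\<close>

lemma represent_on_type:
  assumes "CARD('a::finite) = q" "boolean_fun n q f" "fun_degree n q f \<le> d"
  obtains F :: "(nat \<Rightarrow> 'a::finite) \<Rightarrow> real" where "F \<in> low n d" "boolean F"
    "num_relevant n q f \<le> card {i\<in>{..<n}. relevant i F}"
proof -
  obtain \<phi> :: "'a \<Rightarrow> nat" where "bij_betw \<phi> UNIV {0..<CARD('a)}"
    using ex_bij_betw_finite_nat[of "UNIV :: 'a set"] by auto
  then have \<phi>: "bij_betw \<phi> UNIV {..<q}"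
    using assms(1) by (simp add: atLeast0LessThan)
  define \<psi> where "\<psi> = inv_into UNIV \<phi>"
  have \<phi>_less: "\<phi> a < q" for a
    using bij_betwE[OF \<phi>] by auto
  have \<phi>_\<psi>: "\<phi> (\<psi> k) = k" if "k < q" for k
    unfolding \<psi>_def using \<phi> that by (intro f_inv_into_f) (auto simp: bij_betw_def)
  define emb where "emb y = restrict (\<lambda>i. \<phi> (y i)) {..<n}" for y :: "nat \<Rightarrow> 'a"
  have emb_cube: "emb y \<in> cube n q" for y
    unfolding emb_def cube_def using \<phi>_less by auto
  define F where "F y = f (emb y)" for y
  have "boolean F"
    using assms(2) emb_cube unfolding boolean_def boolean_fun_def F_def by auto
  let ?\<alpha> = "poly_coeffs n q f"
  have F_eq: "F = (\<lambda>y. \<Sum>u\<in>cube n q. ?\<alpha> u * monomial_at n u (emb y))"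
    using represents_poly_coeffs[of n q f] emb_cube unfolding represents_def F_def by auto
  have "F \<in> low n d"
    unfolding F_eq
  proof (rule low_sum)
    fix u assume u: "u \<in> cube n q"
    show "(\<lambda>y. ?\<alpha> u * monomial_at n u (emb y)) \<in> low n d"
    proof (cases "?\<alpha> u = 0")
      case True
      then show ?thesis
        by (simp add: low_def)
    next
      case False
      let ?S = "{i\<in>{..<n}. u i \<noteq> 0}"
      have "finite {weight n u | u. u \<in> cube n q \<and> ?\<alpha> u \<noteq> 0}"
        by (rule finite_subset[of _ "weight n ` cube n q"]) auto
      then have "weight n u \<le> fun_degree n q f"
        unfolding fun_degree_def using u False by (intro Max_ge) auto
      then have card_S: "card ?S \<le> d"
        using assms(3) by (simp add: weight_def)
      have "depends_on ?S (\<lambda>y. monomial_at n u (emb y))"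
        unfolding depends_on_def
      proof (intro allI impI)
        fix y y' :: "nat \<Rightarrow> 'a" assume eq: "\<forall>i\<in>?S. y i = y' i"
        \<comment> \<open>For exponent 0 both sides are 1, even at base 0.\<close>
        have "real (emb y i) ^ u i = real (emb y' i) ^ u i" if "i < n" for i
          using eq that by (cases "u i = 0") (auto simp: emb_def)
        then show "monomial_at n u (emb y) = monomial_at n u (emb y')"
          unfolding monomial_at_def by (intro prod.cong) auto
      qed
      then show ?thesis
        using card_S by (intro low_cmult low_junta[of ?S]) auto
    qed
  qed
  moreover have "{i. relevant_var n q f i} \<subseteq> {i\<in>{..<n}. relevant i F}"
  proof clarify
    fix i assume "relevant_var n q f i"
    then obtain x y where i: "i < n" and x: "x \<in> cube n q" and y: "y \<in> cube n q"
      and xy: "\<And>j. j < n \<Longrightarrow> j \<noteq> i \<Longrightarrow> x j = y j" and ne: "f x \<noteq> f y"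
      unfolding relevant_var_def by auto
    \<comment> \<open>Values of \<open>X\<close> beyond \<open>n\<close> are arbitrary;
      \<open>emb\<close> discards them.\<close>
    define X where "X j = \<psi> (x j)" for j
    have lt: "x j < q" "y j < q" if "j < n" for j
      using x y that by (auto simp: cube_def)
    have "emb (X(i := \<psi> (x i))) = x"
      using x i lt by (intro PiE_ext[of _ "{..<n}" "\<lambda>_. {..<q}"])
        (auto simp: emb_def X_def \<phi>_\<psi> cube_def[symmetric] emb_cube[unfolded emb_def])
    moreover have "emb (X(i := \<psi> (y i))) = y"
      using y i lt xy by (intro PiE_ext[of _ "{..<n}" "\<lambda>_. {..<q}"])
        (auto simp: emb_def X_def \<phi>_\<psi> cube_def[symmetric] emb_cube[unfolded emb_def])
    ultimately have "diff i (\<psi> (x i)) (\<psi> (y i)) F X \<noteq> 0"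
      using ne by (simp add: diff_def F_def)
    then show "i \<in> {..<n} \<and> relevant i F"
      using i unfolding relevant_def by blast
  qed
  then have "num_relevant n q f \<le> card {i\<in>{..<n}. relevant i F}"
    unfolding num_relevant_def by (intro card_mono) auto
  ultimately show thesis
    using that \<open>boolean F\<close> by blast
qed

text \<open>Leaves a single numerical inequality for each \<open>q\<close>. Rounding down to an
  integer turns the real bound into one for the supremum in \<open>enat\<close>.\<close>

lemma max_relevant_le:
  assumes "CARD('a::finite) = q" "2 \<le> q" "1 \<le> d" "0 \<le> C"
    and "(real q - 1) * a = 2" "(real q - 1) * b = 6 + 3 * a" "(real q - 1) * c = 6 + 3 * a + 2 * b"
    "(real q - 1) * e = 2 + a + b + c"
    and "real m * real q / (4 * (real q - 1)) + (a * real m ^ 3 + b * real m ^ 2 + c * real m + e) / real q ^ m \<le> C"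
  shows "ereal_of_enat (max_relevant d q) \<le> ereal (C * real q ^ d)"
proof -
  have bound: "real (num_relevant n q f) \<le> C * real q ^ d"
    if f: "boolean_fun n q f" "fun_degree n q f \<le> d" for n f
  proof -
    obtain F :: "(nat \<Rightarrow> 'a) \<Rightarrow> real" where F: "F \<in> low n d" "boolean F"
      "num_relevant n q f \<le> card {i\<in>{..<n}. relevant i F}"
      using represent_on_type[OF assms(1) f] by blast
    have "real m * real q / (4 * (real q - 1)) + (\<Sum>e\<in>{m<..D}. 2 * real e ^ 3 / real q ^ e) \<le> C" if "m \<le> D" for D
      using sum_cubes_over_powers_le[OF _ assms(5-8) that] assms(2,9) by simp
    then have "card {i\<in>{..<n}. relevant i F} \<le> C * real q ^ d"
      using card_relevant_le[OF F(1) assms(3) F(2), of m C] assms(1,2) by simp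
    with F(3) show ?thesis
      by (meson of_nat_le_iff order.trans)
  qed
  have "max_relevant d q \<le> enat (nat \<lfloor>C * real q ^ d\<rfloor>)"
    unfolding max_relevant_def
  proof (rule Sup_least, clarify)
    fix n f assume "boolean_fun n q f" "fun_degree n q f \<le> d"
    then show "enat (num_relevant n q f) \<le> enat (nat \<lfloor>C * real q ^ d\<rfloor>)"
      using bound by (simp add: le_nat_floor)
  qed
  then have "ereal_of_enat (max_relevant d q) \<le> ereal_of_enat (enat (nat \<lfloor>C * real q ^ d\<rfloor>))"
    by (simp only: ereal_of_enat_le_iff)
  also have "\<dots> \<le> ereal (C * real q ^ d)"
    using assms(4) by (simp add: of_nat_nat)
  finally show ?thesis .
qed

theorem theorem2:
  fixes d :: nat
  assumes "d \<ge> 1"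
  shows "ereal_of_enat (max_relevant d 3) \<le> ereal (2.854 * 3 ^ d) \<and>
         ereal_of_enat (max_relevant d 4) \<le> ereal (1.749 * 4 ^ d) \<and>
         ereal_of_enat (max_relevant d 5) \<le> ereal (1.263 * 5 ^ d) \<and>
         ereal_of_enat (max_relevant d 6) \<le> ereal (0.994 * 6 ^ d) \<and>
         ereal_of_enat (max_relevant d 7) \<le> ereal (0.814 * 7 ^ d)"
proof (intro conjI)
  \<comment> \<open>In each case the numeral type with \<open>q\<close> elements serves as alphabet,
    \<open>m\<close> minimises the bound, \<open>a\<close>, \<open>b\<close>, \<open>c\<close>,
    \<open>e\<close> solve the triangular system, and \<open>C\<close> is the resulting value
    rounded up to three decimals.\<close>
  show "ereal_of_enat (max_relevant d 3) \<le> ereal (2.854 * 3 ^ d)"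
    using max_relevant_le[where 'a = 3 and q = 3 and d = d and m = 6 and C = "2.854" and a = 1
        and b = "9 / 2" and c = 9 and e = "33 / 4"] assms by simp
  show "ereal_of_enat (max_relevant d 4) \<le> ereal (1.749 * 4 ^ d)"
    using max_relevant_le[where 'a = 4 and q = 4 and d = d and m = 4 and C = "1.749" and a = "2 / 3"
        and b = "8 / 3" and c = "40 / 9" and e = "88 / 27"] assms by simp
  show "ereal_of_enat (max_relevant d 5) \<le> ereal (1.263 * 5 ^ d)"
    using max_relevant_le[where 'a = 5 and q = 5 and d = d and m = 3 and C = "1.263" and a = "1 / 2"
        and b = "15 / 8" and c = "45 / 16" and e = "115 / 64"] assms by simp
  show "ereal_of_enat (max_relevant d 6) \<le> ereal (0.994 * 6 ^ d)"
    using max_relevant_le[where 'a = 6 and q = 6 and d = d and m = 2 and C = "0.994" and a = "2 / 5"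
        and b = "36 / 25" and c = "252 / 125" and e = "732 / 625"] assms by simp
  show "ereal_of_enat (max_relevant d 7) \<le> ereal (0.814 * 7 ^ d)"
    using max_relevant_le[where 'a = 7 and q = 7 and d = d and m = 2 and C = "0.814" and a = "1 / 3"
        and b = "7 / 6" and c = "14 / 9" and e = "91 / 108"] assms by simp
qed

end
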